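(* Let $P^*\succeq 0$ be the unique stabilizing solution of the generalized algebraic Riccati equation $$PA+A^\top P+A_1^\top PA_1-PBR^{-1}B^\top P+\gamma^{-2}PEE^\top P+Q=0,$$ and assume that $(A,A_1|C)$ and $(A+\gamma^{-2}EE^\top P^*,A_1|C)$ are exactly detectable and that the system $dx=(Ax+Bu+Ev)\,dt+A_1x\,dW$ is internally stabilizable. Let $P^0\in\mathcal P_0$ and let $\{P^i\}_{i=0}^\infty$ be the sequence generated from $P^0$ by the model-based simultaneous policy update (SPU) algorithm, i.e. for each $i\ge 0$, $P^{i+1}$ is the solution of $$P^{i+1}\overline A^i+(\overline A^i)^\top P^{i+1}+A_1^\top P^{i+1}A_1+\overline Q^i=0,$$ where $\overline A^i=A-BR^{-1}B^\top P^i+\gamma^{-2}EE^\top P^i$ and $\overline Q^i=Q+P^iBR^{-1}B^\top P^i-\gamma^{-2}P^iEE^\top P^i$. Then $P^i\to P^*$ as $i\to\infty$.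
   Context: $\mathcal S^n$ ($\mathcal S^n_+$) is the set of real symmetric (symmetric positive semidefinite) $n\times n$ matrices; $\|\cdot\|_F$ is the Frobenius norm. The matrices $A,A_1\in\mathbb R^{n\times n}$, $B\in\mathbb R^{n\times m}$, $E\in\mathbb R^{n\times p}$, $C$, $D$ are constant real matrices, $D$ has full column rank, $Q=C^\top C$, $R=D^\top D$ (so $R$ is positive definite), $\gamma>0$. $W$ is a one-dimensional standard Brownian motion. Stabilizing solution: a solution $P\succeq0$ of the Riccati equation such that $dx=\mathscr A(P)x\,dt+A_1x\,dW$ is asymptotically mean square stable (i.e. $\mathbb E\|x(t)\|^2\to 0$ for every deterministic $x(0)$), where $\mathscr A(P)=A-BR^{-1}B^\top P+\gamma^{-2}EE^\top P$. Internally stabilizable: there is a feedback $u=-Lx$ such that the solution of $dx=(A-BL)x\,dt+A_1x\,dW$ (that is, $v=0$) satisfies $\mathbb E\|x(t)\|^2\to0$ for every $x(0)$. $(A,A_1|C)$ is exactly detectable if, for the system $dx=Ax\,dt+A_1x\,dW$, $y=Cx$, whenever $y(t)=0$ almost surely for all $t\ge0$ one has $\mathbb E\|x(t)\|^2\to0$. Define $\mathscr F(P)=PA+A^\top P+A_1^\top PA_1-PBR^{-1}B^\top P+\gamma^{-2}PEE^\top P+Q$ on $\mathcal S^n$; its Fréchet derivative at $P$ is the linear operator $\mathscr F'(P)\Delta=\Delta\mathscr A(P)+\mathscr A(P)^\top\Delta+A_1^\top\Delta A_1$ on $\mathcal S^n$. Let $c_0>0$ be a Lipschitz constant of $P\mapsto\mathscr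 F'(P)$ (operator norm induced by $\|\cdot\|_F$) and let $a_0>0$ be a constant with $\|(\mathscr F'(P^* ))^{-1}\|\le a_0$. Then $$\mathcal P_0=\Big\{P\in\mathcal S^n_+ : \|P-P^*\|_F\le\frac{2-\sqrt2}{2c_0a_0}\Big\}.$$ *)

theory Defs
  imports "HOL-Probability.Probability"
begin

section \<open>Symmetric matrices\<close>

definition sym_mats :: "(real^'n^'n) set" where
  "sym_mats = {X. transpose X = X}"

definition psd_mats :: "(real^'n^'n) set" where
  "psd_mats = {X \<in> sym_mats. \<forall>v. 0 \<le> v \<bullet> (X *v v)}"

text \<open>The norm of the type \<^typ>\<open>real^'n^'m\<close> is the Frobenius norm.\<close>

lemma norm_matrix_frobenius:
  fixes X :: "real^'n^'m"
  shows "norm X = sqrt (\<Sum>i\<in>UNIV. \<Sum>j\<in>UNIV. (X $ i $ j)\<^sup>2)"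
  by (simp add: norm_vec_def L2_set_def sum_nonneg)

text \<open>The operator norm, induced by the Frobenius norm, of a linear operator on the space of
  symmetric matrices: \<^const>\<open>onorm\<close> with the supremum restricted to that space.\<close>

definition sym_onorm :: "(real^'n^'n \<Rightarrow> real^'n^'n) \<Rightarrow> real" where
  "sym_onorm T = (SUP X\<in>sym_mats. norm (T X) / norm X)"


section \<open>Brownian motion and linear stochastic differential equations\<close>

definition natural_filtration :: "'w measure \<Rightarrow> (real \<Rightarrow> 'w \<Rightarrow> real) \<Rightarrow> real \<Rightarrow> 'w measure" where
  "natural_filtration M W t =
     sigma (space M) {W s -` U \<inter> space M | s U. s \<in> {0..t} \<and> U \<in> sets borel}"

text \<open>The natural filtration completed with the null sets of \<^term>\<open>M\<close>, so that being adapted is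
  not affected by modifications on null sets.\<close>

definition augmented_filtration :: "'w measure \<Rightarrow> (real \<Rightarrow> 'w \<Rightarrow> real) \<Rightarrow> real \<Rightarrow> 'w measure" where
  "augmented_filtration M W t =
     sigma (space M) (sets (natural_filtration M W t) \<union> null_sets M)"

definition brownian_motion :: "'w measure \<Rightarrow> (real \<Rightarrow> 'w \<Rightarrow> real) \<Rightarrow> bool" where
  "brownian_motion M W \<longleftrightarrow>
     prob_space M \<and>
     (\<forall>t\<ge>0. W t \<in> borel_measurable M) \<and>
     (AE \<omega> in M. W 0 \<omega> = 0) \<and>
     (\<forall>s t. 0 \<le> s \<and> s < t \<longrightarrow>
        distributed M lborel (\<lambda>\<omega>. W t \<omega> - W s \<omega>) (normal_density 0 (sqrt (t - s)))) \<and>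
     (\<forall>s t. 0 \<le> s \<and> s < t \<longrightarrow>
        prob_space.indep_set M (sets (natural_filtration M W s))
          (sets (vimage_algebra (space M) (\<lambda>\<omega>. W t \<omega> - W s \<omega>) borel))) \<and>
     (AE \<omega> in M. continuous_on {0..} (\<lambda>t. W t \<omega>))"

text \<open>A simple integrand is given by a partition \<^term>\<open>ts\<close> and coefficients \<^term>\<open>\<xi>\<close>; its value on
  the interval from \<^term>\<open>ts ! i\<close> (excluded) to \<^term>\<open>ts ! Suc i\<close> (included) is \<^term>\<open>\<xi> i\<close>.\<close>

definition simple_integrand ::
  "'w measure \<Rightarrow> (real \<Rightarrow> 'w \<Rightarrow> real) \<Rightarrow> real list \<Rightarrow> (nat \<Rightarrow> 'w \<Rightarrow> real^'n) \<Rightarrow> bool" where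
  "simple_integrand M W ts \<xi> \<longleftrightarrow>
     sorted ts \<and> set ts \<subseteq> {0..} \<and>
     (\<forall>i. Suc i < length ts \<longrightarrow>
        \<xi> i \<in> borel_measurable (augmented_filtration M W (ts ! i)) \<and>
        (\<exists>c. \<forall>\<omega>\<in>space M. norm (\<xi> i \<omega>) \<le> c))"

definition simple_process :: "real list \<Rightarrow> (nat \<Rightarrow> 'w \<Rightarrow> real^'n) \<Rightarrow> real \<Rightarrow> 'w \<Rightarrow> real^'n" where
  "simple_process ts \<xi> t \<omega> =
     (\<Sum>i<length ts - 1. indicator {ts ! i <.. ts ! Suc i} t *\<^sub>R \<xi> i \<omega>)"

definition simple_ito_integral ::
  "(real \<Rightarrow> 'w \<Rightarrow> real) \<Rightarrow> real list \<Rightarrow> (nat \<Rightarrow> 'w \<Rightarrow> real^'n) \<Rightarrow> real \<Rightarrow> 'w \<Rightarrow> real^'n" where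
  "simple_ito_integral W ts \<xi> t \<omega> =
     (\<Sum>i<length ts - 1. (W (min t (ts ! Suc i)) \<omega> - W (min t (ts ! i)) \<omega>) *\<^sub>R \<xi> i \<omega>)"

text \<open>\<^term>\<open>I\<close> is (a version of) the Ito integral of \<^term>\<open>h\<close> over the interval from 0 to
  \<^term>\<open>t\<close>: the mean square limit of the integrals of simple integrands converging to
  \<^term>\<open>h\<close> in mean square.\<close>

definition has_ito_integral ::
  "'w measure \<Rightarrow> (real \<Rightarrow> 'w \<Rightarrow> real) \<Rightarrow> (real \<Rightarrow> 'w \<Rightarrow> real^'n) \<Rightarrow> real \<Rightarrow> ('w \<Rightarrow> real^'n) \<Rightarrow> bool" where
  "has_ito_integral M W h t I \<longleftrightarrow>
     I \<in> borel_measurable M \<and>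
     (\<exists>ts \<xi>. (\<forall>k::nat. simple_integrand M W (ts k) (\<xi> k)) \<and>
        (\<lambda>k. \<integral>\<^sup>+\<omega>. (\<integral>\<^sup>+s\<in>{0..t}. ennreal ((norm (h s \<omega> - simple_process (ts k) (\<xi> k) s \<omega>))\<^sup>2) \<partial>lborel) \<partial>M)
           \<longlonglongrightarrow> 0 \<and>
        (\<lambda>k. \<integral>\<^sup>+\<omega>. ennreal ((norm (simple_ito_integral W (ts k) (\<xi> k) t \<omega> - I \<omega>))\<^sup>2) \<partial>M)
           \<longlonglongrightarrow> 0)"

text \<open>Solutions of \<open>dx = F x dt + G x dW\<close>, \<open>x(0) = x0\<close> deterministic, that is
  \<open>x(t) = x0 + \<integral> F x(s) ds + \<integral> G x(s) dW(s)\<close> (integrals from 0 to \<open>t\<close>) almost surely, in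
  the usual class of continuous adapted square integrable processes.\<close>

definition sde_solution ::
  "'w measure \<Rightarrow> (real \<Rightarrow> 'w \<Rightarrow> real) \<Rightarrow> real^'n^'n \<Rightarrow> real^'n^'n \<Rightarrow> real^'n \<Rightarrow>
   (real \<Rightarrow> 'w \<Rightarrow> real^'n) \<Rightarrow> bool" where
  "sde_solution M W F G x0 x \<longleftrightarrow>
     (\<forall>t\<ge>0. x t \<in> borel_measurable (augmented_filtration M W t)) \<and>
     (AE \<omega> in M. continuous_on {0..} (\<lambda>t. x t \<omega>)) \<and>
     (\<forall>t\<ge>0. integrable M (\<lambda>\<omega>. (norm (x t \<omega>))\<^sup>2)) \<and>
     (\<forall>t\<ge>0. (\<integral>\<^sup>+\<omega>. (\<integral>\<^sup>+s\<in>{0..t}. ennreal ((norm (x s \<omega>))\<^sup>2) \<partial>lborel) \<partial>M) < \<infinity>) \<and>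
     (\<forall>t\<ge>0. \<exists>I. has_ito_integral M W (\<lambda>s \<omega>. G *v x s \<omega>) t I \<and>
        (AE \<omega> in M. x t \<omega> = x0 + integral {0..t} (\<lambda>s. F *v x s \<omega>) + I \<omega>))"

definition mean_square_decays :: "'w measure \<Rightarrow> (real \<Rightarrow> 'w \<Rightarrow> real^'n) \<Rightarrow> bool" where
  "mean_square_decays M x \<longleftrightarrow>
     ((\<lambda>t. prob_space.expectation M (\<lambda>\<omega>. (norm (x t \<omega>))\<^sup>2)) \<longlongrightarrow> 0) at_top"

text \<open>A linear equation has exactly one solution up to indistinguishability. Stability speaks about
  ``the'' solution, so the definition below asks for a solution and for the decay of each one; in
  particular it cannot hold vacuously.\<close>

definition ms_stable ::
  "'w measure \<Rightarrow> (real \<Rightarrow> 'w \<Rightarrow> real) \<Rightarrow> real^'n^'n \<Rightarrow> real^'n^'n \<Rightarrow> bool" where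
  "ms_stable M W F G \<longleftrightarrow>
     (\<forall>x0. (\<exists>x. sde_solution M W F G x0 x) \<and>
           (\<forall>x. sde_solution M W F G x0 x \<longrightarrow> mean_square_decays M x))"

definition exactly_detectable ::
  "'w measure \<Rightarrow> (real \<Rightarrow> 'w \<Rightarrow> real) \<Rightarrow> real^'n^'n \<Rightarrow> real^'n^'n \<Rightarrow> real^'n^'q \<Rightarrow> bool" where
  "exactly_detectable M W A A1 C \<longleftrightarrow>
     (\<forall>x0 x. sde_solution M W A A1 x0 x \<and> (\<forall>t\<ge>0. AE \<omega> in M. C *v x t \<omega> = 0)
        \<longrightarrow> mean_square_decays M x)"

definition internally_stabilizable ::
  "'w measure \<Rightarrow> (real \<Rightarrow> 'w \<Rightarrow> real) \<Rightarrow> real^'n^'n \<Rightarrow> real^'n^'n \<Rightarrow> real^'m^'n \<Rightarrow> bool" where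
  "internally_stabilizable M W A A1 B \<longleftrightarrow>
     (\<exists>L :: real^'n^'m. ms_stable M W (A - B ** L) A1)"


section \<open>The generalized algebraic Riccati equation\<close>

definition closed_loop ::
  "real^'n^'n \<Rightarrow> real^'m^'n \<Rightarrow> real^'p^'n \<Rightarrow> real^'m^'m \<Rightarrow> real \<Rightarrow> real^'n^'n \<Rightarrow> real^'n^'n" where
  "closed_loop A B E R \<gamma> P =
     A - B ** matrix_inv R ** transpose B ** P + (1 / \<gamma>\<^sup>2) *\<^sub>R (E ** transpose E ** P)"

definition riccati_op ::
  "real^'n^'n \<Rightarrow> real^'n^'n \<Rightarrow> real^'m^'n \<Rightarrow> real^'p^'n \<Rightarrow> real^'n^'n \<Rightarrow> real^'m^'m \<Rightarrow> real \<Rightarrow>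
   real^'n^'n \<Rightarrow> real^'n^'n" where
  "riccati_op A A1 B E Q R \<gamma> P =
     P ** A + transpose A ** P + transpose A1 ** P ** A1
       - P ** B ** matrix_inv R ** transpose B ** P
       + (1 / \<gamma>\<^sup>2) *\<^sub>R (P ** E ** transpose E ** P) + Q"

text \<open>The Frechet derivative of \<^const>\<open>riccati_op\<close>, see \<open>riccati_op_has_derivative\<close> below. At a
  stabilizing solution it is a bijection of \<^const>\<open>sym_mats\<close>, so there its inverse on that space
  is given by \<^const>\<open>inv_into\<close>.\<close>

definition riccati_deriv ::
  "real^'n^'n \<Rightarrow> real^'n^'n \<Rightarrow> real^'m^'n \<Rightarrow> real^'p^'n \<Rightarrow> real^'m^'m \<Rightarrow> real \<Rightarrow>
   real^'n^'n \<Rightarrow> real^'n^'n \<Rightarrow> real^'n^'n" where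
  "riccati_deriv A A1 B E R \<gamma> P \<Delta> =
     \<Delta> ** closed_loop A B E R \<gamma> P + transpose (closed_loop A B E R \<gamma> P) ** \<Delta>
       + transpose A1 ** \<Delta> ** A1"

definition stabilizing_solution ::
  "'w measure \<Rightarrow> (real \<Rightarrow> 'w \<Rightarrow> real) \<Rightarrow>
   real^'n^'n \<Rightarrow> real^'n^'n \<Rightarrow> real^'m^'n \<Rightarrow> real^'p^'n \<Rightarrow> real^'n^'n \<Rightarrow> real^'m^'m \<Rightarrow> real \<Rightarrow>
   real^'n^'n \<Rightarrow> bool" where
  "stabilizing_solution M W A A1 B E Q R \<gamma> P \<longleftrightarrow>
     P \<in> psd_mats \<and> riccati_op A A1 B E Q R \<gamma> P = 0 \<and> ms_stable M W (closed_loop A B E R \<gamma> P) A1"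

definition spu_weight ::
  "real^'m^'n \<Rightarrow> real^'p^'n \<Rightarrow> real^'n^'n \<Rightarrow> real^'m^'m \<Rightarrow> real \<Rightarrow> real^'n^'n \<Rightarrow> real^'n^'n" where
  "spu_weight B E Q R \<gamma> P =
     Q + P ** B ** matrix_inv R ** transpose B ** P
       - (1 / \<gamma>\<^sup>2) *\<^sub>R (P ** E ** transpose E ** P)"

definition spu_step ::
  "real^'n^'n \<Rightarrow> real^'n^'n \<Rightarrow> real^'m^'n \<Rightarrow> real^'p^'n \<Rightarrow> real^'n^'n \<Rightarrow> real^'m^'m \<Rightarrow> real \<Rightarrow>
   real^'n^'n \<Rightarrow> real^'n^'n \<Rightarrow> bool" where
  "spu_step A A1 B E Q R \<gamma> P P' \<longleftrightarrow>
     P' \<in> sym_mats \<and>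
     P' ** closed_loop A B E R \<gamma> P + transpose (closed_loop A B E R \<gamma> P) ** P'
       + transpose A1 ** P' ** A1 + spu_weight B E Q R \<gamma> P = 0"

definition initial_region :: "real \<Rightarrow> real \<Rightarrow> real^'n^'n \<Rightarrow> (real^'n^'n) set" where
  "initial_region c0 a0 Pstar = {P \<in> psd_mats. norm (P - Pstar) \<le> (2 - sqrt 2) / (2 * c0 * a0)}"


subsection \<open>The Frechet derivative of the Riccati operator\<close>

lemma bounded_bilinear_matrix_mult:
  "bounded_bilinear ((**) :: real^'n^'m \<Rightarrow> real^'p^'n \<Rightarrow> real^'p^'m)"
proof -
  have "bilinear ((**) :: real^'n^'m \<Rightarrow> real^'p^'n \<Rightarrow> real^'p^'m)"
    unfolding bilinear_def
    by (auto intro!: linearI simp: matrix_add_ldistrib scalar_matrix_assoc matrix_scalar_ac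
        matrix_matrix_mult_def vec_eq_iff sum.distrib algebra_simps sum_distrib_left)
  then show ?thesis by (simp add: bilinear_conv_bounded_bilinear)
qed

lemma transpose_add: "transpose (X + Y :: real^'n^'m) = transpose X + transpose Y"
  by (simp add: transpose_def vec_eq_iff)

lemma transpose_diff: "transpose (X - Y :: real^'n^'m) = transpose X - transpose Y"
  by (simp add: transpose_def vec_eq_iff)

lemma transpose_matrix_inv_sym:
  fixes R :: "real^'m^'m"
  assumes "invertible R" and "transpose R = R"
  shows "transpose (matrix_inv R) = matrix_inv R"
proof -
  have 1: "R ** matrix_inv R = mat 1" and 2: "matrix_inv R ** R = mat 1"
    using assms(1) someI_ex[of "\<lambda>Y. R ** Y = mat 1 \<and> Y ** R = mat 1"]
    by (auto simp: invertible_def matrix_inv_def)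
  have "transpose (matrix_inv R) ** R = mat 1"
    using arg_cong[OF 1, of transpose] assms(2) by (simp add: matrix_transpose_mul)
  then have "transpose (matrix_inv R) ** R ** matrix_inv R = matrix_inv R" by simp
  then show ?thesis by (simp add: matrix_mul_assoc[symmetric] 1)
qed

lemma riccati_op_has_derivative:
  assumes P: "P \<in> sym_mats" and R: "invertible R" "transpose R = R"
  shows "(riccati_op A A1 B E Q R \<gamma> has_derivative riccati_deriv A A1 B E R \<gamma> P) (at P)"
proof -
  note mult = bounded_bilinear.FDERIV[OF bounded_bilinear_matrix_mult]
  have "transpose P = P" using P by (simp add: sym_mats_def)
  note transposes = this transpose_matrix_inv_sym[OF R]
  have "riccati_op A A1 B E Q R \<gamma> = (\<lambda>P. P ** A + transpose A ** P + transpose A1 ** P ** A1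
       - P ** B ** matrix_inv R ** transpose B ** P
       + (1 / \<gamma>\<^sup>2) *\<^sub>R (P ** E ** transpose E ** P) + Q)"
    by (simp add: fun_eq_iff riccati_op_def)
  moreover have "(\<dots> has_derivative riccati_deriv A A1 B E R \<gamma> P) (at P)"
    apply (rule has_derivative_eq_rhs)
     apply (rule has_derivative_add has_derivative_diff has_derivative_scaleR_right mult
        has_derivative_const has_derivative_ident)+
    apply (simp add: fun_eq_iff riccati_deriv_def closed_loop_def transpose_add transpose_diff
        transpose_scalar matrix_transpose_mul transposes
        matrix_mul_assoc algebra_simps
        bounded_bilinear.add_left[OF bounded_bilinear_matrix_mult]
        bounded_bilinear.add_right[OF bounded_bilinear_matrix_mult]
        bounded_bilinear.diff_left[OF bounded_bilinear_matrix_mult]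
        bounded_bilinear.diff_right[OF bounded_bilinear_matrix_mult]
        bounded_bilinear.zero_left[OF bounded_bilinear_matrix_mult]
        bounded_bilinear.zero_right[OF bounded_bilinear_matrix_mult]
        bounded_bilinear.scaleR_left[OF bounded_bilinear_matrix_mult]
        bounded_bilinear.scaleR_right[OF bounded_bilinear_matrix_mult])
    done
  ultimately show ?thesis by simp
qed

end

theory Submission
  imports Defs
begin

text \<open>
  The simultaneous policy update is Newton's method for the Riccati equation. Put
  \<open>N = \<gamma>\<^sup>-\<^sup>2 E E\<^sup>T - B R\<^sup>-\<^sup>1 B\<^sup>T\<close>, so that the Riccati operator is the quadratic map
  \<open>\<Phi> P = P A + A\<^sup>T P + A1\<^sup>T P A1 + P N P + Q\<close>, and let \<open>X\<close> and \<open>X'\<close> be the errors \<open>P - P*\<close> before and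
  after a step. Then \<open>\<Phi>' P X' = X N X\<close> (\<open>spu_step_error\<close>). Since \<open>\<Phi>' P X - \<Phi>' P* X = 2 X N X\<close>
  (\<open>riccati_deriv_diff\<close>), the Lipschitz constant \<open>c0\<close> bounds the norm of \<open>X N X\<close> by \<open>c0/2 e\<^sup>2\<close>, where \<open>e\<close>
  is the norm of \<open>X\<close>. Moving the derivative from \<open>P\<close> to \<open>P*\<close> and applying the bound \<open>a0\<close> for the inverse
  gives \<open>e' \<le> a0 (c0/2 e\<^sup>2 + c0 e e')\<close> for the norm \<open>e'\<close> of \<open>X'\<close>. As soon as \<open>a0 c0 e \<le> 1/2\<close>, which the
  initial region guarantees, this yields \<open>e' \<le> e/2\<close>, and the errors decay geometrically.

  The analytic content is in the use of \<open>a0\<close>: a bound for the inverse of \<open>\<Phi>' P*\<close> is informative only if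
  this operator is injective on the symmetric matrices (\<open>norm_le_of_sym_inverse_bound\<close>). It is the
  Lyapunov operator of the closed loop equation \<open>dx = F x dt + G x dW\<close>, and its injectivity is a
  consequence of mean square stability (\<open>ms_stable_lyapunov_kernel\<close>): for a symmetric \<open>\<Delta>\<close> in the kernel
  the expectation of \<open>x\<^sup>T \<Delta> x\<close> is constant in time by Ito's formula, and it tends to \<open>0\<close> by stability,
  so that the quadratic form of \<open>\<Delta>\<close> vanishes at every initial value.

  Only the expectation of Ito's formula for quadratic forms is needed (\<open>second_moment_formula\<close>), and it
  follows from two properties of the Ito integral: the isometry (\<open>ito_isometry\<close>) and the martingale
  property (\<open>ito_martingale\<close>). Both are computed for simple integrands from the conditional mean and
  variance of Brownian increments, and carried over to mean square limits.
\<close>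

section \<open>Square integrable functions\<close>

definition square_integrable :: "'a measure \<Rightarrow> ('a \<Rightarrow> 'b::euclidean_space) \<Rightarrow> bool" where
  "square_integrable N X \<longleftrightarrow> X \<in> borel_measurable N \<and> integrable N (\<lambda>w. (norm (X w))\<^sup>2)"

lemma square_integrable_measurable [measurable_dest]:
  "square_integrable N X \<Longrightarrow> X \<in> borel_measurable N"
  by (simp add: square_integrable_def)

lemma square_integrable_iff_nn_integral:
  "square_integrable N X \<longleftrightarrow>
     X \<in> borel_measurable N \<and> (\<integral>\<^sup>+w. ennreal ((norm (X w))\<^sup>2) \<partial>N) < \<infinity>"
  by (auto simp: square_integrable_def integrable_iff_bounded)

lemma square_integrable_dominated:
  assumes "square_integrable N X" and "Y \<in> borel_measurable N"
    and "\<And>w. w \<in> space N \<Longrightarrow> norm (Y w) \<le> c * norm (X w)"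
  shows "square_integrable N Y"
proof -
  have iX: "integrable N (\<lambda>w. c\<^sup>2 * (norm (X w))\<^sup>2)"
    using assms(1) by (simp add: square_integrable_def)
  have "(norm (Y w))\<^sup>2 \<le> c\<^sup>2 * (norm (X w))\<^sup>2" if "w \<in> space N" for w
    using power_mono[OF assms(3)[OF that], of 2] by (simp add: power_mult_distrib)
  then have "AE w in N. norm ((norm (Y w))\<^sup>2) \<le> norm (c\<^sup>2 * (norm (X w))\<^sup>2)"
    by (intro AE_I2) simp
  then have "integrable N (\<lambda>w. (norm (Y w))\<^sup>2)"
    using assms(2) Bochner_Integration.integrable_bound[OF iX, of "\<lambda>w. (norm (Y w))\<^sup>2"] by auto
  then show ?thesis using assms(2) by (simp add: square_integrable_def)
qed

lemma integrable_inner: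
  assumes X: "square_integrable N X" and Y: "square_integrable N Y"
  shows "integrable N (\<lambda>w. X w \<bullet> Y w)"
proof (rule Bochner_Integration.integrable_bound)
  show "integrable N (\<lambda>w. (norm (X w))\<^sup>2 + (norm (Y w))\<^sup>2)"
    using X Y by (simp add: square_integrable_def)
  show "(\<lambda>w. X w \<bullet> Y w) \<in> borel_measurable N" using X Y by measurable
  have "norm (X w \<bullet> Y w) \<le> norm ((norm (X w))\<^sup>2 + (norm (Y w))\<^sup>2)" for w
  proof -
    have "\<bar>X w \<bullet> Y w\<bar> \<le> norm (X w) * norm (Y w)" by (rule Cauchy_Schwarz_ineq2)
    also have "\<dots> \<le> (norm (X w))\<^sup>2 + (norm (Y w))\<^sup>2"
      using sum_squares_bound[of "norm (X w)" "norm (Y w)"] mult_nonneg_nonneg[OF norm_ge_zero norm_ge_zero, of "X w" "Y w"]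
      by linarith
    finally show ?thesis by simp
  qed
  then show "AE w in N. norm (X w \<bullet> Y w) \<le> norm ((norm (X w))\<^sup>2 + (norm (Y w))\<^sup>2)" by simp
qed

lemma norm_add_squared_le:
  fixes x y :: "'a::real_inner"
  shows "(norm (x + y))\<^sup>2 \<le> 2 * (norm x)\<^sup>2 + 2 * (norm y)\<^sup>2"
proof -
  have "0 \<le> (norm (x - y))\<^sup>2" by simp
  then show ?thesis by (simp add: power2_norm_eq_inner inner_simps inner_commute)
qed

lemma square_integrable_add:
  assumes X: "square_integrable N X" and Y: "square_integrable N Y"
  shows "square_integrable N (\<lambda>w. X w + Y w)"
proof -
  have "integrable N (\<lambda>w. 2 * (norm (X w))\<^sup>2 + 2 * (norm (Y w))\<^sup>2)"
    using X Y by (simp add: square_integrable_def)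
  then have "integrable N (\<lambda>w. (norm (X w + Y w))\<^sup>2)"
    by (rule Bochner_Integration.integrable_bound)
      (use X Y in \<open>auto intro!: norm_add_squared_le simp: square_integrable_def\<close>)
  then show ?thesis using X Y by (auto simp: square_integrable_def)
qed

lemma square_integrable_bounded_linear:
  assumes "square_integrable N X" and "bounded_linear f"
  shows "square_integrable N (\<lambda>w. f (X w))"
proof -
  obtain K where K: "\<And>x. norm (f x) \<le> norm x * K"
    using bounded_linear.bounded[OF assms(2)] by blast
  have "f \<in> borel_measurable borel"
    using assms(2) by (intro borel_measurable_continuous_onI linear_continuous_on)
  from measurable_compose[OF square_integrable_measurable[OF assms(1)] this]
  show ?thesis
    by (rule square_integrable_dominated[OF assms(1), of _ K]) (use K in \<open>simp add: mult.commute\<close>)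
qed

lemma square_integrable_diff:
  assumes X: "square_integrable N X" and Y: "square_integrable N Y"
  shows "square_integrable N (\<lambda>w. X w - Y w)"
proof -
  have "square_integrable N (\<lambda>w. - Y w)" using Y by (auto simp: square_integrable_def)
  from square_integrable_add[OF X this] show ?thesis by simp
qed

lemma square_integrable_matrix:
  fixes X :: "'a \<Rightarrow> real^'n" and F :: "real^'n^'m"
  assumes "square_integrable N X"
  shows "square_integrable N (\<lambda>w. F *v X w)"
  using square_integrable_bounded_linear[where f="(*v) F", OF assms] by simp

lemma square_integrable_zero: "square_integrable N (\<lambda>w. 0)"
  by (simp add: square_integrable_def)

lemma square_integrable_sum:
  "(\<And>i. i \<in> I \<Longrightarrow> square_integrable N (X i)) \<Longrightarrow> square_integrable N (\<lambda>w. \<Sum>i\<in>I. X i w)"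
proof (induction I rule: infinite_finite_induct)
  case (insert i I)
  then have "square_integrable N (\<lambda>w. X i w + (\<Sum>j\<in>I. X j w))"
    by (simp add: square_integrable_add)
  then show ?case using insert.hyps by simp
qed (simp_all add: square_integrable_zero)

lemma Cauchy_Schwarz_integral:
  assumes X: "square_integrable N X" and Y: "square_integrable N Y"
  shows "\<bar>\<integral>w. X w \<bullet> Y w \<partial>N\<bar> \<le> sqrt (\<integral>w. (norm (X w))\<^sup>2 \<partial>N) * sqrt (\<integral>w. (norm (Y w))\<^sup>2 \<partial>N)"
proof -
  define a b c where "a = (\<integral>w. (norm (X w))\<^sup>2 \<partial>N)" and "b = (\<integral>w. (norm (Y w))\<^sup>2 \<partial>N)"
    and "c = (\<integral>w. X w \<bullet> Y w \<partial>N)"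
  have iX: "integrable N (\<lambda>w. (norm (X w))\<^sup>2)" and iY: "integrable N (\<lambda>w. (norm (Y w))\<^sup>2)"
    using X Y by (simp_all add: square_integrable_def)
  note iXY = integrable_inner[OF X Y]
  have ab: "0 \<le> a" "0 \<le> b" by (simp_all add: a_def b_def)
  \<comment> \<open>The form \<open>(s, t) \<mapsto> \<integral> (norm (s X - t Y))\<^sup>2\<close> is positive semidefinite; the claim is the sign of its
    discriminant.\<close>
  have quad: "0 \<le> s\<^sup>2 * a - 2 * s * t * c + t\<^sup>2 * b" for s t
  proof -
    have "0 \<le> (\<integral>w. (norm (s *\<^sub>R X w - t *\<^sub>R Y w))\<^sup>2 \<partial>N)" by simp
    also have "\<dots> = (\<integral>w. s\<^sup>2 * (norm (X w))\<^sup>2 - 2 * s * t * (X w \<bullet> Y w) + t\<^sup>2 * (norm (Y w))\<^sup>2 \<partial>N)"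
      by (intro Bochner_Integration.integral_cong refl, unfold power2_norm_eq_inner)
        (simp add: inner_simps inner_commute algebra_simps power2_eq_square)
    also have "\<dots> = s\<^sup>2 * a - 2 * s * t * c + t\<^sup>2 * b"
      using iX iY iXY by (simp add: a_def b_def c_def)
    finally show ?thesis .
  qed
  have "c\<^sup>2 \<le> a * b"
  proof (cases "b = 0")
    case True
    show ?thesis
    proof (rule ccontr)
      assume "\<not> c\<^sup>2 \<le> a * b"
      then have "c \<noteq> 0" using True by auto
      then have "2 * 1 * ((a + 1) / (2 * c)) * c = a + 1" by simp
      then show False using quad[of 1 "(a + 1) / (2 * c)"] True by simp
    qed
  next
    case False
    then have "0 \<le> b * (b * a - c\<^sup>2)"
      using quad[of b c] by (simp add: power2_eq_square algebra_simps)
    then show ?thesis using False ab by (simp add: zero_le_mult_iff mult.commute)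
  qed
  then have "\<bar>c\<bar> \<le> sqrt (a * b)" by (simp add: real_le_rsqrt)
  then show ?thesis by (simp add: a_def b_def c_def real_sqrt_mult)
qed

text \<open>The integrands and integrals in the definition of the Ito integral converge in terms of
  nonnegative integrals, which need no integrability. A finite distance to one square integrable
  function already makes the limit square integrable, and the distances become Bochner integrals.\<close>

lemma mean_square_limit:
  assumes X: "\<And>k. square_integrable N (X k)" and Y: "Y \<in> borel_measurable N"
    and lim: "(\<lambda>k. \<integral>\<^sup>+w. ennreal ((norm (X k w - Y w))\<^sup>2) \<partial>N) \<longlonglongrightarrow> 0"
  shows "square_integrable N Y" and "(\<lambda>k. \<integral>w. (norm (X k w - Y w))\<^sup>2 \<partial>N) \<longlonglongrightarrow> 0"
proof -
  have "\<forall>\<^sub>F k in sequentially. (\<integral>\<^sup>+w. ennreal ((norm (X k w - Y w))\<^sup>2) \<partial>N) < 1"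
    using lim by (rule order_tendstoD) simp
  then obtain k where "(\<integral>\<^sup>+w. ennreal ((norm (X k w - Y w))\<^sup>2) \<partial>N) < 1"
    by (auto simp: eventually_sequentially)
  then have "square_integrable N (\<lambda>w. X k w - Y w)"
    using X[of k] Y by (auto simp: square_integrable_iff_nn_integral intro: order.strict_trans)
  from square_integrable_diff[OF X[of k] this] show SY: "square_integrable N Y" by simp
  have "(\<integral>\<^sup>+w. ennreal ((norm (X k w - Y w))\<^sup>2) \<partial>N) = ennreal (\<integral>w. (norm (X k w - Y w))\<^sup>2 \<partial>N)" for k
    using square_integrable_diff[OF X[of k] SY]
    by (intro nn_integral_eq_integral) (auto simp: square_integrable_def)
  with lim show "(\<lambda>k. \<integral>w. (norm (X k w - Y w))\<^sup>2 \<partial>N) \<longlonglongrightarrow> 0"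
    by (simp add: ennreal_tendsto_0_iff)
qed

lemma null_sequence_comparison:
  fixes f g :: "nat \<Rightarrow> real"
  assumes "\<And>k. \<bar>f k\<bar> \<le> g k" and "g \<longlonglongrightarrow> 0"
  shows "f \<longlonglongrightarrow> 0"
  by (rule Lim_null_comparison[OF always_eventually assms(2)]) (simp add: assms(1))

text \<open>Continuity of the inner product of \<open>L\<^sup>2\<close>. Both sides of the Ito isometry and of the martingale
  property are such inner products, so both pass from simple integrands to the limit by this lemma.\<close>

lemma tendsto_integral_inner:
  assumes X: "\<And>k. square_integrable N (X k)" "square_integrable N X'"
    and Y: "\<And>k. square_integrable N (Y k)" "square_integrable N Y'"
    and lX: "(\<lambda>k. \<integral>w. (norm (X k w - X' w))\<^sup>2 \<partial>N) \<longlonglongrightarrow> 0"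
    and lY: "(\<lambda>k. \<integral>w. (norm (Y k w - Y' w))\<^sup>2 \<partial>N) \<longlonglongrightarrow> 0"
  shows "(\<lambda>k. \<integral>w. X k w \<bullet> Y k w \<partial>N) \<longlonglongrightarrow> (\<integral>w. X' w \<bullet> Y' w \<partial>N)"
proof -
  let ?x = "\<lambda>k. sqrt (\<integral>w. (norm (X k w - X' w))\<^sup>2 \<partial>N)" and ?y = "\<lambda>k. sqrt (\<integral>w. (norm (Y k w - Y' w))\<^sup>2 \<partial>N)"
  let ?a = "sqrt (\<integral>w. (norm (X' w))\<^sup>2 \<partial>N)" and ?b = "sqrt (\<integral>w. (norm (Y' w))\<^sup>2 \<partial>N)"
  have bound: "\<bar>(\<integral>w. X k w \<bullet> Y k w \<partial>N) - (\<integral>w. X' w \<bullet> Y' w \<partial>N)\<bar> \<le> ?x k * ?y k + ?x k * ?b + ?a * ?y k" for k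
  proof -
    note dX = square_integrable_diff[OF X(1)[of k] X(2)] and dY = square_integrable_diff[OF Y(1)[of k] Y(2)]
    have "(\<integral>w. X k w \<bullet> Y k w \<partial>N) = (\<integral>w. (X k w - X' w) \<bullet> (Y k w - Y' w) + (X k w - X' w) \<bullet> Y' w
        + X' w \<bullet> (Y k w - Y' w) + X' w \<bullet> Y' w \<partial>N)"
      by (intro Bochner_Integration.integral_cong refl) (simp add: inner_simps)
    also have "\<dots> = (\<integral>w. (X k w - X' w) \<bullet> (Y k w - Y' w) \<partial>N) + (\<integral>w. (X k w - X' w) \<bullet> Y' w \<partial>N)
        + (\<integral>w. X' w \<bullet> (Y k w - Y' w) \<partial>N) + (\<integral>w. X' w \<bullet> Y' w \<partial>N)"
      by (simp add: integrable_inner[OF dX dY] integrable_inner[OF dX Y(2)]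
          integrable_inner[OF X(2) dY] integrable_inner[OF X(2) Y(2)])
    finally show ?thesis
      using Cauchy_Schwarz_integral[OF dX dY] Cauchy_Schwarz_integral[OF dX Y(2)]
        Cauchy_Schwarz_integral[OF X(2) dY] by simp
  qed
  have "(\<lambda>k. ?x k * ?y k + ?x k * ?b + ?a * ?y k) \<longlonglongrightarrow> sqrt 0 * sqrt 0 + sqrt 0 * ?b + ?a * sqrt 0"
    by (intro tendsto_intros lX lY)
  then have lim: "(\<lambda>k. ?x k * ?y k + ?x k * ?b + ?a * ?y k) \<longlonglongrightarrow> 0"
    by (simp only: real_sqrt_zero mult_zero_left mult_zero_right add_0_right)
  show ?thesis by (rule LIM_zero_cancel[OF null_sequence_comparison[OF bound lim]])
qed

lemma mean_square_limit_matrix: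
  fixes X :: "nat \<Rightarrow> 'a \<Rightarrow> real^'n" and F :: "real^'n^'m"
  assumes X: "\<And>k. square_integrable N (X k)" and Y: "square_integrable N Y"
    and lim: "(\<lambda>k. \<integral>w. (norm (X k w - Y w))\<^sup>2 \<partial>N) \<longlonglongrightarrow> 0"
  shows "(\<lambda>k. \<integral>w. (norm (F *v X k w - F *v Y w))\<^sup>2 \<partial>N) \<longlonglongrightarrow> 0"
proof -
  obtain K where K: "\<And>x. norm (F *v x) \<le> norm x * K"
    using bounded_linear.bounded[OF matrix_vector_mul_bounded_linear, of F] by blast
  have "(\<integral>w. (norm (F *v X k w - F *v Y w))\<^sup>2 \<partial>N) \<le> (\<integral>w. K\<^sup>2 * (norm (X k w - Y w))\<^sup>2 \<partial>N)" for k
  proof (rule integral_mono)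
    have d: "square_integrable N (\<lambda>w. X k w - Y w)" by (rule square_integrable_diff[OF X Y])
    show "integrable N (\<lambda>w. K\<^sup>2 * (norm (X k w - Y w))\<^sup>2)"
      using d by (simp add: square_integrable_def)
    show "integrable N (\<lambda>w. (norm (F *v X k w - F *v Y w))\<^sup>2)"
      using square_integrable_matrix[OF d, of F]
      by (simp add: square_integrable_def matrix_vector_mult_diff_distrib)
    show "(norm (F *v X k w - F *v Y w))\<^sup>2 \<le> K\<^sup>2 * (norm (X k w - Y w))\<^sup>2" for w
      using power_mono[OF K[of "X k w - Y w"], of 2]
      by (simp add: matrix_vector_mult_diff_distrib power_mult_distrib mult.commute)
  qed
  then have bound: "\<bar>\<integral>w. (norm (F *v X k w - F *v Y w))\<^sup>2 \<partial>N\<bar> \<le> (\<integral>w. K\<^sup>2 * (norm (X k w - Y w))\<^sup>2 \<partial>N)" for k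
    by (subst abs_of_nonneg) simp_all
  have "(\<lambda>k. \<integral>w. K\<^sup>2 * (norm (X k w - Y w))\<^sup>2 \<partial>N) \<longlonglongrightarrow> 0"
    using tendsto_mult_left[OF lim, of "K\<^sup>2"] by simp
  then show ?thesis by (rule null_sequence_comparison[OF bound])
qed

text \<open>The triangle inequality for mean square distances, up to a factor that a null sequence does not
  see.\<close>

lemma mean_square_null_trans:
  assumes sq: "\<And>k. square_integrable N (X k)" "\<And>k. square_integrable N (Y k)" "\<And>k. square_integrable N (Z k)"
    and XY: "(\<lambda>k. \<integral>w. (norm (X k w - Y k w))\<^sup>2 \<partial>N) \<longlonglongrightarrow> 0"
    and YZ: "(\<lambda>k. \<integral>w. (norm (Y k w - Z k w))\<^sup>2 \<partial>N) \<longlonglongrightarrow> 0"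
  shows "(\<lambda>k. \<integral>w. (norm (X k w - Z k w))\<^sup>2 \<partial>N) \<longlonglongrightarrow> 0"
proof -
  have bound: "\<bar>\<integral>w. (norm (X k w - Z k w))\<^sup>2 \<partial>N\<bar>
      \<le> 2 * (\<integral>w. (norm (X k w - Y k w))\<^sup>2 \<partial>N) + 2 * (\<integral>w. (norm (Y k w - Z k w))\<^sup>2 \<partial>N)" for k
  proof -
    have i: "integrable N (\<lambda>w. (norm (X k w - Y k w))\<^sup>2)" "integrable N (\<lambda>w. (norm (Y k w - Z k w))\<^sup>2)"
        "integrable N (\<lambda>w. (norm (X k w - Z k w))\<^sup>2)"
      using square_integrable_diff[OF sq(1)[of k] sq(2)[of k]] square_integrable_diff[OF sq(2)[of k] sq(3)[of k]]
        square_integrable_diff[OF sq(1)[of k] sq(3)[of k]] by (simp_all add: square_integrable_def)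
    have "(\<integral>w. (norm (X k w - Z k w))\<^sup>2 \<partial>N)
        \<le> (\<integral>w. 2 * (norm (X k w - Y k w))\<^sup>2 + 2 * (norm (Y k w - Z k w))\<^sup>2 \<partial>N)"
    proof (rule integral_mono)
      show "(norm (X k w - Z k w))\<^sup>2 \<le> 2 * (norm (X k w - Y k w))\<^sup>2 + 2 * (norm (Y k w - Z k w))\<^sup>2" for w
        using norm_add_squared_le[of "X k w - Y k w" "Y k w - Z k w"] by simp
    qed (use i in simp_all)
    then show "\<bar>\<integral>w. (norm (X k w - Z k w))\<^sup>2 \<partial>N\<bar>
      \<le> 2 * (\<integral>w. (norm (X k w - Y k w))\<^sup>2 \<partial>N) + 2 * (\<integral>w. (norm (Y k w - Z k w))\<^sup>2 \<partial>N)"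
      using i by (subst abs_of_nonneg) simp_all
  qed
  have "(\<lambda>k. 2 * (\<integral>w. (norm (X k w - Y k w))\<^sup>2 \<partial>N) + 2 * (\<integral>w. (norm (Y k w - Z k w))\<^sup>2 \<partial>N)) \<longlonglongrightarrow> 2 * 0 + 2 * 0"
    by (intro tendsto_intros XY YZ)
  then have "(\<lambda>k. 2 * (\<integral>w. (norm (X k w - Y k w))\<^sup>2 \<partial>N) + 2 * (\<integral>w. (norm (Y k w - Z k w))\<^sup>2 \<partial>N)) \<longlonglongrightarrow> 0"
    by (simp only: mult_zero_right add_0_right)
  then show ?thesis by (rule null_sequence_comparison[OF bound])
qed

section \<open>Increments of Brownian motion\<close>

locale brownian = prob_space M for M :: "'w measure" +
  fixes W :: "real \<Rightarrow> 'w \<Rightarrow> real"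
  assumes brownian_motion: "brownian_motion M W"
begin

abbreviation \<F> :: "real \<Rightarrow> 'w measure" where "\<F> \<equiv> augmented_filtration M W"

lemma W_measurable: "0 \<le> t \<Longrightarrow> W t \<in> borel_measurable M"
  using brownian_motion by (simp add: brownian_motion_def)

lemma space_filtration: "space (\<F> t) = space M"
  by (simp add: augmented_filtration_def space_measure_of_conv)

lemma sets_natural_filtration:
  "sets (natural_filtration M W t) =
     sigma_sets (space M) {W s -` U \<inter> space M | s U. s \<in> {0..t} \<and> U \<in> sets borel}"
  unfolding natural_filtration_def by (rule sets_measure_of) auto

lemma sets_natural_filtration_subset: "sets (natural_filtration M W t) \<subseteq> sets M"
  unfolding sets_natural_filtration
  by (rule sets.sigma_sets_subset) (auto intro: measurable_sets[OF W_measurable])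

lemma sets_filtration:
  "sets (\<F> t) = sigma_sets (space M) (sets (natural_filtration M W t) \<union> null_sets M)"
proof -
  have "sets (natural_filtration M W t) \<union> null_sets M \<subseteq> sets M"
    using sets_natural_filtration_subset by auto
  also have "\<dots> \<subseteq> Pow (space M)" by (rule sets.space_closed)
  finally show ?thesis unfolding augmented_filtration_def by (rule sets_measure_of)
qed

lemma subalgebra_filtration: "subalgebra M (\<F> t)"
  unfolding subalgebra_def space_filtration sets_filtration
  using sets_natural_filtration_subset by (auto intro!: sets.sigma_sets_subset)

lemma sets_filtration_mono:
  assumes "s \<le> t" shows "sets (\<F> s) \<subseteq> sets (\<F> t)"
proof -
  have "sets (natural_filtration M W s) \<subseteq> sets (natural_filtration M W t)"
    unfolding sets_natural_filtration using assms by (intro sigma_sets_mono') force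
  then show ?thesis unfolding sets_filtration by (intro sigma_sets_mono') blast
qed

lemma adapted_measurable: "X \<in> borel_measurable (\<F> t) \<Longrightarrow> X \<in> borel_measurable M"
  by (rule measurable_from_subalg[OF subalgebra_filtration])

lemma adapted_mono:
  assumes "s \<le> t" "X \<in> borel_measurable (\<F> s)" shows "X \<in> borel_measurable (\<F> t)"
proof -
  have "subalgebra (\<F> t) (\<F> s)"
    using sets_filtration_mono[OF assms(1)] by (simp add: subalgebra_def space_filtration)
  from measurable_from_subalg[OF this assms(2)] show ?thesis .
qed

lemma W_adapted:
  assumes "0 \<le> s" "s \<le> t" shows "W s \<in> borel_measurable (\<F> t)"
proof (rule measurableI)
  fix U :: "real set" assume "U \<in> sets borel"
  then have "W s -` U \<inter> space M \<in> sets (natural_filtration M W t)"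
    unfolding sets_natural_filtration using assms by (intro sigma_sets.Basic) auto
  then show "W s -` U \<inter> space (\<F> t) \<in> sets (\<F> t)"
    unfolding sets_filtration space_filtration by (intro sigma_sets.Basic) simp
qed simp

text \<open>The sets that agree almost surely with a set of the natural filtration form a sigma algebra that
  contains the natural filtration and the null sets. This transfers the independence of increments
  from the natural to the augmented filtration.\<close>

lemma filtration_AE_eq_natural:
  assumes "S \<in> sets (\<F> t)"
  shows "\<exists>S'\<in>sets (natural_filtration M W t). AE w in M. w \<in> S \<longleftrightarrow> w \<in> S'"
  using assms unfolding sets_filtration
proof induction
  case (Basic a)
  then show ?case
  proof
    assume "a \<in> null_sets M"
    from AE_not_in[OF this] have "AE w in M. w \<in> a \<longleftrightarrow> w \<in> {}" by eventually_elim simp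
    then show ?case by blast
  qed blast
next
  case Empty
  then show ?case by blast
next
  case (Compl a)
  then obtain S' where S': "S' \<in> sets (natural_filtration M W t)" "AE w in M. w \<in> a \<longleftrightarrow> w \<in> S'" by blast
  have "space (natural_filtration M W t) = space M"
    by (simp add: natural_filtration_def space_measure_of_conv)
  then have "space M - S' \<in> sets (natural_filtration M W t)"
    using sets.compl_sets[OF S'(1)] by simp
  moreover have "AE w in M. w \<in> space M - a \<longleftrightarrow> w \<in> space M - S'"
    using S'(2) by eventually_elim simp
  ultimately show ?case by blast
next
  case (Union a)
  then obtain S' where S': "\<And>i. S' i \<in> sets (natural_filtration M W t)"
    "\<And>i::nat. AE w in M. w \<in> a i \<longleftrightarrow> w \<in> S' i" by metis
  have "(\<Union>i. S' i) \<in> sets (natural_filtration M W t)" using S'(1) by blast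
  moreover have "AE w in M. \<forall>i. w \<in> a i \<longleftrightarrow> w \<in> S' i" using S'(2) by (simp add: AE_all_countable)
  then have "AE w in M. w \<in> (\<Union>i. a i) \<longleftrightarrow> w \<in> (\<Union>i. S' i)" by eventually_elim simp
  ultimately show ?case by blast
qed

definition increment :: "real \<Rightarrow> real \<Rightarrow> 'w \<Rightarrow> real" where
  "increment a b w = W b w - W a w"

lemma increment_measurable: "0 \<le> a \<Longrightarrow> 0 \<le> b \<Longrightarrow> increment a b \<in> borel_measurable M"
  unfolding increment_def[abs_def] using W_measurable[of a] W_measurable[of b] by measurable

lemma increment_adapted:
  "0 \<le> a \<Longrightarrow> a \<le> t \<Longrightarrow> 0 \<le> b \<Longrightarrow> b \<le> t \<Longrightarrow> increment a b \<in> borel_measurable (\<F> t)"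
  unfolding increment_def[abs_def] using W_adapted[of a t] W_adapted[of b t] by measurable

lemma indep_increment:
  assumes "0 \<le> s" "s < t" and X: "X \<in> borel_measurable (\<F> s)"
  shows "indep_var borel X borel (increment s t)"
proof -
  let ?V = "sets (vimage_algebra (space M) (increment s t) borel)"
  have nat: "indep_set (sets (natural_filtration M W s)) ?V"
    using brownian_motion assms unfolding brownian_motion_def increment_def[abs_def] by blast
  have aug: "indep_set (sets (\<F> s)) ?V"
    unfolding indep_sets2_eq
  proof (intro conjI ballI)
    show "sets (\<F> s) \<subseteq> events" using subalgebra_filtration by (simp add: subalgebra_def)
    show V: "?V \<subseteq> events" using nat by (simp add: indep_sets2_eq)
    fix S T assume S: "S \<in> sets (\<F> s)" and T: "T \<in> ?V"
    obtain S' where S': "S' \<in> sets (natural_filtration M W s)" and eq: "AE w in M. w \<in> S \<longleftrightarrow> w \<in> S'"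
      using filtration_AE_eq_natural[OF S] by blast
    have ev: "S \<in> events" "S' \<in> events" "T \<in> events"
      using S S' T V subalgebra_filtration[of s] sets_natural_filtration_subset[of s]
      unfolding subalgebra_def by blast+
    have "prob (S \<inter> T) = prob (S' \<inter> T)"
      by (rule measure_eq_AE) (use eq ev in \<open>auto elim: eventually_mono\<close>)
    also have "\<dots> = prob S' * prob T" by (rule indep_setD[OF nat S' T])
    also have "prob S' = prob S"
      by (rule measure_eq_AE) (use eq ev in \<open>auto elim: eventually_mono\<close>)
    finally show "prob (S \<inter> T) = prob S * prob T" .
  qed
  have sub: "sigma_sets (space M) {X -` U \<inter> space M |U. U \<in> sets borel} \<subseteq> sets (\<F> s)"
    using sets.sigma_sets_subset[of "{X -` U \<inter> space M |U. U \<in> sets borel}" "\<F> s"]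
      measurable_sets[OF X] by (auto simp: space_filtration)
  have "indep_set (sigma_sets (space M) {X -` U \<inter> space M |U. U \<in> sets borel}) ?V"
    using aug sub unfolding indep_sets2_eq by blast
  then show ?thesis
    using adapted_measurable[OF X] increment_measurable[of s t] assms(1,2)
    unfolding indep_var_eq by (simp add: sets_vimage_algebra)
qed

lemma increment_moments:
  assumes "0 \<le> s" "s < t"
  shows "integrable M (increment s t)" "integrable M (\<lambda>w. (increment s t w)\<^sup>2)"
    and "expectation (increment s t) = 0" "expectation (\<lambda>w. (increment s t w)\<^sup>2) = t - s"
proof -
  have pos: "0 < sqrt (t - s)" using assms by simp
  have D: "distributed M lborel (increment s t) (normal_density 0 (sqrt (t - s)))"
    using brownian_motion assms unfolding brownian_motion_def increment_def[abs_def] by blast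
  have mom: "integrable M (\<lambda>w. (increment s t w) ^ k)" for k
    using distributed_integrable[OF D, of "\<lambda>x. x ^ k"] integrable_normal_moment[OF pos, of 0 k]
    by simp
  from mom[of 1] mom[of 2] show "integrable M (increment s t)" "integrable M (\<lambda>w. (increment s t w)\<^sup>2)"
    by simp_all
  show E0: "expectation (increment s t) = 0" by (rule normal_distributed_expectation[OF pos D])
  show "expectation (\<lambda>w. (increment s t w)\<^sup>2) = t - s"
    using normal_distributed_variance[OF pos D] assms by (simp add: E0)
qed

text \<open>The two facts on Brownian motion from which all further stochastic calculus follows: an increment
  has conditional mean \<open>0\<close> and conditional variance \<open>t - s\<close>, tested against an integrable variable of
  the past.\<close>

lemma expectation_increment:
  assumes "0 \<le> s" "s \<le> t" and Z: "Z \<in> borel_measurable (\<F> s)" and int: "integrable M Z"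
  shows "integrable M (\<lambda>w. Z w * increment s t w)"
    and "expectation (\<lambda>w. Z w * increment s t w) = 0"
    and "integrable M (\<lambda>w. Z w * (increment s t w)\<^sup>2)"
    and "expectation (\<lambda>w. Z w * (increment s t w)\<^sup>2) = (t - s) * expectation Z"
proof -
  have "integrable M (\<lambda>w. Z w * increment s t w) \<and> expectation (\<lambda>w. Z w * increment s t w) = 0 \<and>
    integrable M (\<lambda>w. Z w * (increment s t w)\<^sup>2) \<and>
    expectation (\<lambda>w. Z w * (increment s t w)\<^sup>2) = (t - s) * expectation Z"
  proof (cases "s = t")
    case True
    then have "increment s t w = 0" for w by (simp add: increment_def)
    with True show ?thesis by simp
  next
    case False
    then have st: "s < t" using assms by simp
    note ind = indep_increment[OF assms(1) st Z]
    have "indep_var borel ((\<lambda>x. x) \<circ> Z) borel ((\<lambda>x. x\<^sup>2) \<circ> increment s t)"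
      by (rule indep_var_compose[OF ind]) measurable
    then have ind2: "indep_var borel Z borel (\<lambda>w. (increment s t w)\<^sup>2)" by (simp add: comp_def)
    note m = increment_moments[OF assms(1) st]
    show ?thesis
      using indep_var_integrable[OF ind int m(1)] indep_var_lebesgue_integral[OF ind int m(1)]
        indep_var_integrable[OF ind2 int m(2)] indep_var_lebesgue_integral[OF ind2 int m(2)] m(3,4)
      by simp
  qed
  then show "integrable M (\<lambda>w. Z w * increment s t w)" "expectation (\<lambda>w. Z w * increment s t w) = 0"
    "integrable M (\<lambda>w. Z w * (increment s t w)\<^sup>2)"
    "expectation (\<lambda>w. Z w * (increment s t w)\<^sup>2) = (t - s) * expectation Z"
    by simp_all
qed

lemma square_integrable_increment:
  assumes "0 \<le> a" "0 \<le> b" shows "square_integrable M (increment a b)"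
proof -
  consider "a < b" | "b < a" | "a = b" by linarith
  then show ?thesis
  proof cases
    case 1
    then show ?thesis
      using increment_moments(2)[OF assms(1) 1] increment_measurable[OF assms]
      by (simp add: square_integrable_def)
  next
    case 2
    then show ?thesis
      using increment_moments(2)[OF assms(2) 2] increment_measurable[OF assms]
      by (simp add: square_integrable_def increment_def power2_commute)
  next
    case 3
    then have "increment a b = (\<lambda>w. 0)" by (simp add: increment_def fun_eq_iff)
    then show ?thesis by (simp add: square_integrable_zero)
  qed
qed

lemma square_integrable_increment_scaleR:
  fixes X :: "'w \<Rightarrow> 'b::euclidean_space"
  assumes "0 \<le> a" "0 \<le> b" and X: "X \<in> borel_measurable M" "\<And>w. w \<in> space M \<Longrightarrow> norm (X w) \<le> c"
  shows "square_integrable M (\<lambda>w. increment a b w *\<^sub>R X w)"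
proof (rule square_integrable_dominated[OF square_integrable_increment[OF assms(1,2)]])
  show "(\<lambda>w. increment a b w *\<^sub>R X w) \<in> borel_measurable M"
    using X(1) increment_measurable[OF assms(1,2)] by measurable
  show "norm (increment a b w *\<^sub>R X w) \<le> c * norm (increment a b w)" if "w \<in> space M" for w
    using mult_right_mono[OF X(2)[OF that], of "\<bar>increment a b w\<bar>"] by (simp add: mult.commute)
qed

text \<open>The core of the isometry. The two intervals may overlap in any way or not at all. Working with
  pairs of intervals makes it possible to multiply two simple integrals without refining their
  partitions to a common one.\<close>

lemma expectation_increment_pair_le:
  assumes ord: "0 \<le> a" "a \<le> c" "a \<le> b" "c \<le> d"
    and Z: "Z \<in> borel_measurable (\<F> c)" "\<And>w. w \<in> space M \<Longrightarrow> \<bar>Z w\<bar> \<le> K"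
  shows "expectation (\<lambda>w. increment a b w * increment c d w * Z w) = max 0 (min b d - c) * expectation Z"
proof -
  have ZM: "Z \<in> borel_measurable M" by (rule adapted_measurable[OF Z(1)])
  have intZ: "integrable M Z"
    by (rule integrable_const_bound[where B=K]) (use Z(2) ZM in auto)
  have intZi: "integrable M (\<lambda>w. Z w * increment u v w)" if "0 \<le> u" "0 \<le> v" for u v
  proof -
    have "integrable M (\<lambda>w. (increment u v w *\<^sub>R Z w) \<bullet> 1)"
      by (intro integrable_inner square_integrable_increment_scaleR[OF that ZM])
        (use Z(2) in \<open>auto simp: square_integrable_def\<close>)
    then show ?thesis by (simp add: mult.commute)
  qed
  show ?thesis
  proof (cases "b \<le> c")
    case True
    have "(\<lambda>w. Z w * increment a b w) \<in> borel_measurable (\<F> c)"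
      using Z(1) increment_adapted[OF ord(1,2) order_trans[OF ord(1,3)] True] by measurable
    from expectation_increment(2)[OF _ _ this, of d] intZi[of a b] ord True show ?thesis
      by (simp add: mult_ac)
  next
    case False
    define m where "m = min b d"
    have m: "c \<le> m" "m \<le> b" "m \<le> d" using False ord by (auto simp: m_def)
    \<comment> \<open>Only the common part of the two intervals contributes.\<close>
    have split: "increment a b w * increment c d w * Z w =
        Z w * increment a c w * increment c d w + Z w * (increment c m w)\<^sup>2
        + Z w * increment c m w * increment m d w + Z w * increment c d w * increment m b w" for w
      by (simp add: increment_def algebra_simps power2_eq_square)
    have t1: "integrable M (\<lambda>w. Z w * increment a c w * increment c d w)"
      "expectation (\<lambda>w. Z w * increment a c w * increment c d w) = 0"
    proof -
      have "(\<lambda>w. Z w * increment a c w) \<in> borel_measurable (\<F> c)"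
        using Z(1) increment_adapted[OF ord(1,2) order_trans[OF ord(1,2)] order_refl] by measurable
      from expectation_increment(1,2)[OF _ _ this intZi, of d] ord
      show "integrable M (\<lambda>w. Z w * increment a c w * increment c d w)"
        "expectation (\<lambda>w. Z w * increment a c w * increment c d w) = 0" by auto
    qed
    have t2: "integrable M (\<lambda>w. Z w * (increment c m w)\<^sup>2)"
      "expectation (\<lambda>w. Z w * (increment c m w)\<^sup>2) = (m - c) * expectation Z"
      using expectation_increment(3,4)[OF _ m(1) Z(1) intZ] ord by auto
    have t3: "integrable M (\<lambda>w. Z w * increment c m w * increment m d w)"
      "expectation (\<lambda>w. Z w * increment c m w * increment m d w) = 0"
    proof -
      have "increment c m \<in> borel_measurable (\<F> m)" using ord m by (intro increment_adapted) auto
      then have "(\<lambda>w. Z w * increment c m w) \<in> borel_measurable (\<F> m)"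
        using adapted_mono[OF m(1) Z(1)] by measurable
      from expectation_increment(1,2)[OF _ _ this intZi, of d] ord m
      show "integrable M (\<lambda>w. Z w * increment c m w * increment m d w)"
        "expectation (\<lambda>w. Z w * increment c m w * increment m d w) = 0" by auto
    qed
    have t4: "integrable M (\<lambda>w. Z w * increment c d w * increment m b w) \<and>
      expectation (\<lambda>w. Z w * increment c d w * increment m b w) = 0"
    proof (cases "b \<le> d")
      case True
      then have "increment m b w = 0" for w by (simp add: m_def increment_def)
      then show ?thesis by simp
    next
      case False
      then have md: "m = d" by (simp add: m_def)
      have "increment c d \<in> borel_measurable (\<F> d)" using ord by (intro increment_adapted) auto
      then have "(\<lambda>w. Z w * increment c d w) \<in> borel_measurable (\<F> d)"
        using adapted_mono[OF ord(4) Z(1)] by measurable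
      from expectation_increment(1,2)[OF _ _ this intZi, of b] ord m md
      show ?thesis by auto
    qed
    show ?thesis
      using t1 t2 t3 t4 m(1) unfolding split by (simp add: m_def)
  qed
qed

lemma expectation_increment_pair:
  assumes ord: "0 \<le> a" "0 \<le> c" "a \<le> b" "c \<le> d"
    and Z: "Z \<in> borel_measurable (\<F> (max a c))" "\<And>w. w \<in> space M \<Longrightarrow> \<bar>Z w\<bar> \<le> K"
  shows "expectation (\<lambda>w. increment a b w * increment c d w * Z w)
      = max 0 (min b d - max a c) * expectation Z"
proof (cases "a \<le> c")
  case True
  then show ?thesis using expectation_increment_pair_le[of a c b d Z K] assms by (simp add: max_absorb2)
next
  case False
  then have "c \<le> a" by simp
  then have "expectation (\<lambda>w. increment c d w * increment a b w * Z w) = max 0 (min d b - a) * expectation Z"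
    using expectation_increment_pair_le[of c a d b Z K] assms by (simp add: max_absorb1)
  then show ?thesis using \<open>c \<le> a\<close>
    by (simp add: max_absorb1 min.commute mult.commute[of "increment a b _"])
qed

end

section \<open>The Ito isometry for simple integrands\<close>

text \<open>Processes are compared as functions on the product of the probability space and the time axis, with
  the horizon encoded as an indicator, so that one product measure serves all horizons.\<close>

definition on_interval :: "real \<Rightarrow> (real \<Rightarrow> 'w \<Rightarrow> 'b::real_vector) \<Rightarrow> 'w \<times> real \<Rightarrow> 'b" where
  "on_interval t h = (\<lambda>(w, s). indicator {0..t} s *\<^sub>R h s w)"

text \<open>A simple process is a sum of such functions.\<close>

definition rectangle :: "real \<Rightarrow> real \<Rightarrow> ('w \<Rightarrow> 'b::real_vector) \<Rightarrow> 'w \<times> real \<Rightarrow> 'b" where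
  "rectangle a b X = (\<lambda>(w, s). indicator {a<..b} s *\<^sub>R X w)"

lemma integral_double_sum:
  fixes f :: "'i \<Rightarrow> 'j \<Rightarrow> 'a \<Rightarrow> real"
  assumes "\<And>i j. i \<in> I \<Longrightarrow> j \<in> J \<Longrightarrow> integrable N (f i j)"
  shows "(\<integral>x. (\<Sum>i\<in>I. \<Sum>j\<in>J. f i j x) \<partial>N) = (\<Sum>i\<in>I. \<Sum>j\<in>J. \<integral>x. f i j x \<partial>N)"
proof -
  have "(\<integral>x. (\<Sum>i\<in>I. \<Sum>j\<in>J. f i j x) \<partial>N) = (\<Sum>i\<in>I. \<integral>x. (\<Sum>j\<in>J. f i j x) \<partial>N)"
    by (intro Bochner_Integration.integral_sum Bochner_Integration.integrable_sum assms)
  also have "\<dots> = (\<Sum>i\<in>I. \<Sum>j\<in>J. \<integral>x. f i j x \<partial>N)"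
    by (intro sum.cong refl Bochner_Integration.integral_sum assms)
  finally show ?thesis .
qed

context brownian
begin

sublocale cylinder: pair_sigma_finite M lborel ..

abbreviation cylinder :: "('w \<times> real) measure" where "cylinder \<equiv> M \<Otimes>\<^sub>M lborel"

lemma rectangle_measurable:
  fixes X :: "'w \<Rightarrow> 'b::euclidean_space"
  assumes [measurable]: "X \<in> borel_measurable M"
  shows "rectangle a b X \<in> borel_measurable cylinder"
  unfolding rectangle_def by measurable

lemma square_integrable_rectangle:
  fixes X :: "'w \<Rightarrow> 'b::euclidean_space"
  assumes "square_integrable M X"
  shows "square_integrable cylinder (rectangle a b X)"
proof -
  have X [measurable]: "X \<in> borel_measurable M" using assms by (rule square_integrable_measurable)
  have "(\<integral>\<^sup>+p. ennreal ((norm (rectangle a b X p))\<^sup>2) \<partial>cylinder)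
      = (\<integral>\<^sup>+w. (\<integral>\<^sup>+s. ennreal ((norm (rectangle a b X (w, s)))\<^sup>2) \<partial>lborel) \<partial>M)"
    by (rule lborel.nn_integral_fst[symmetric]) (use rectangle_measurable[OF X, of a b] in measurable)
  also have "\<dots> = (\<integral>\<^sup>+w. ennreal ((norm (X w))\<^sup>2) * emeasure lborel {a<..b} \<partial>M)"
  proof (rule nn_integral_cong)
    fix w
    have "(\<integral>\<^sup>+s. ennreal ((norm (rectangle a b X (w, s)))\<^sup>2) \<partial>lborel)
        = (\<integral>\<^sup>+s. ennreal ((norm (X w))\<^sup>2) * indicator {a<..b} s \<partial>lborel)"
      by (intro nn_integral_cong) (auto simp: rectangle_def indicator_def)
    then show "(\<integral>\<^sup>+s. ennreal ((norm (rectangle a b X (w, s)))\<^sup>2) \<partial>lborel)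
        = ennreal ((norm (X w))\<^sup>2) * emeasure lborel {a<..b}"
      by (simp add: nn_integral_cmult_indicator)
  qed
  also have "\<dots> = (\<integral>\<^sup>+w. ennreal ((norm (X w))\<^sup>2) \<partial>M) * emeasure lborel {a<..b}"
    by (rule nn_integral_multc) measurable
  also have "\<dots> < \<infinity>"
  proof -
    have "emeasure lborel {a<..b} < \<infinity>" by (cases "a \<le> b") auto
    then show ?thesis using assms by (simp add: square_integrable_iff_nn_integral ennreal_mult_less_top)
  qed
  finally show ?thesis
    using rectangle_measurable[OF X] by (simp add: square_integrable_iff_nn_integral)
qed

lemma integral_rectangle_inner:
  fixes X Y :: "'w \<Rightarrow> 'b::euclidean_space"
  assumes X: "square_integrable M X" and Y: "square_integrable M Y"
  shows "(\<integral>p. rectangle a b X p \<bullet> rectangle c d Y p \<partial>cylinder)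
      = max 0 (min b d - max a c) * expectation (\<lambda>w. X w \<bullet> Y w)"
proof -
  have "(\<integral>p. rectangle a b X p \<bullet> rectangle c d Y p \<partial>cylinder)
      = expectation (\<lambda>w. \<integral>s. rectangle a b X (w, s) \<bullet> rectangle c d Y (w, s) \<partial>lborel)"
    by (rule cylinder.integral_fst'[symmetric])
      (intro integrable_inner square_integrable_rectangle X Y)
  also have "\<dots> = expectation (\<lambda>w. max 0 (min b d - max a c) * (X w \<bullet> Y w))"
  proof (intro Bochner_Integration.integral_cong refl)
    fix w
    have "(\<integral>s. rectangle a b X (w, s) \<bullet> rectangle c d Y (w, s) \<partial>lborel)
        = (\<integral>s. indicator {max a c<..min b d} s * (X w \<bullet> Y w) \<partial>lborel)"
      by (intro Bochner_Integration.integral_cong refl) (auto simp: rectangle_def indicator_def)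
    also have "\<dots> = measure lborel {max a c<..min b d} * (X w \<bullet> Y w)" by simp
    also have "measure lborel {max a c<..min b d} = max 0 (min b d - max a c)"
      by (cases "max a c \<le> min b d") (simp_all del: max_less_iff_conj min_less_iff_conj max.bounded_iff min.bounded_iff)
    finally show "(\<integral>s. rectangle a b X (w, s) \<bullet> rectangle c d Y (w, s) \<partial>lborel)
        = max 0 (min b d - max a c) * (X w \<bullet> Y w)" .
  qed
  finally show ?thesis by simp
qed

text \<open>Stopping at \<open>t\<close> moves an interval that starts after \<open>t\<close> to the degenerate interval at \<open>t\<close>, where the
  coefficient is no longer measurable with respect to the past; but then the increment vanishes.\<close>

lemma expectation_stopped_increment_pair:
  fixes X Y :: "'w \<Rightarrow> 'b::euclidean_space"
  assumes ord: "0 \<le> a" "0 \<le> c" "a \<le> b" "c \<le> d"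
    and X: "X \<in> borel_measurable (\<F> a)" "\<And>w. w \<in> space M \<Longrightarrow> norm (X w) \<le> K"
    and Y: "Y \<in> borel_measurable (\<F> c)" "\<And>w. w \<in> space M \<Longrightarrow> norm (Y w) \<le> L"
  shows "expectation (\<lambda>w. (increment (min t a) (min t b) w *\<^sub>R X w) \<bullet> (increment (min t c) (min t d) w *\<^sub>R Y w))
      = max 0 (min (min t b) (min t d) - max a c) * expectation (\<lambda>w. X w \<bullet> Y w)"
proof (cases "max a c \<le> t")
  case True
  have Z: "(\<lambda>w. X w \<bullet> Y w) \<in> borel_measurable (\<F> (max a c))"
    using adapted_mono[OF _ X(1), of "max a c"] adapted_mono[OF _ Y(1), of "max a c"] by simp
  have bound: "\<bar>X w \<bullet> Y w\<bar> \<le> K * L" if "w \<in> space M" for w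
    using Cauchy_Schwarz_ineq2[of "X w" "Y w"] mult_mono[OF X(2)[OF that] Y(2)[OF that]]
      order_trans[OF norm_ge_zero X(2)[OF that]] by simp
  have "expectation (\<lambda>w. increment a (min t b) w * increment c (min t d) w * (X w \<bullet> Y w))
      = max 0 (min (min t b) (min t d) - max a c) * expectation (\<lambda>w. X w \<bullet> Y w)"
    by (rule expectation_increment_pair[OF _ _ _ _ Z bound]) (use ord True in auto)
  moreover have "min t a = a" "min t c = c" using True by auto
  moreover have "(p *\<^sub>R x) \<bullet> (q *\<^sub>R y) = p * q * (x \<bullet> y)" for p q and x y :: 'b
    by simp
  ultimately show ?thesis by (simp only:)
next
  case False
  \<comment> \<open>One of the two intervals starts after \<open>t\<close>, and both sides vanish.\<close>
  have stopped: "increment (min t u) (min t v) = (\<lambda>w. 0)" if "t < u" "u \<le> v" for u v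
  proof -
    have "min t u = t" "min t v = t" using that by linarith+
    then show ?thesis by (simp add: increment_def fun_eq_iff)
  qed
  have "increment (min t a) (min t b) = (\<lambda>w. 0) \<or> increment (min t c) (min t d) = (\<lambda>w. 0)"
    using stopped[of a b] stopped[of c d] ord False by linarith
  then have "expectation (\<lambda>w. (increment (min t a) (min t b) w *\<^sub>R X w)
      \<bullet> (increment (min t c) (min t d) w *\<^sub>R Y w)) = 0"
    by (elim disjE) (simp_all only: scaleR_zero_left inner_zero_left inner_zero_right integral_zero)
  moreover have "max 0 (min (min t b) (min t d) - max a c) = 0" using False by linarith
  ultimately show ?thesis by (simp only: mult_zero_left)
qed

lemma simple_integrandD:
  assumes "simple_integrand M W ts \<xi>" and "i < length ts - 1"
  shows "0 \<le> ts ! i" "ts ! i \<le> ts ! Suc i" "\<xi> i \<in> borel_measurable (\<F> (ts ! i))"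
    and "\<exists>K. \<forall>w\<in>space M. norm (\<xi> i w) \<le> K"
proof -
  have "ts ! i \<in> set ts" using assms(2) by simp
  then show "0 \<le> ts ! i" using assms(1) unfolding simple_integrand_def by auto
  show "ts ! i \<le> ts ! Suc i" "\<xi> i \<in> borel_measurable (\<F> (ts ! i))"
    "\<exists>K. \<forall>w\<in>space M. norm (\<xi> i w) \<le> K"
    using assms unfolding simple_integrand_def by (auto simp: sorted_nth_mono)
qed

lemma square_integrable_coefficient:
  assumes "simple_integrand M W ts \<xi>" and "i < length ts - 1"
  shows "square_integrable M (\<xi> i)"
proof -
  obtain K where "\<forall>w\<in>space M. norm (\<xi> i w) \<le> K" using simple_integrandD(4)[OF assms] by blast
  then show ?thesis
    using adapted_measurable[OF simple_integrandD(3)[OF assms]]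
    by (intro square_integrable_dominated[of M "\<lambda>w. 1::real" "\<xi> i" K])
      (auto simp: square_integrable_def)
qed

lemma simple_ito_integral_eq:
  "simple_ito_integral W ts \<xi> t w =
     (\<Sum>i<length ts - 1. increment (min t (ts ! i)) (min t (ts ! Suc i)) w *\<^sub>R \<xi> i w)"
  by (simp add: simple_ito_integral_def increment_def)

lemma square_integrable_ito_term:
  assumes "simple_integrand M W ts \<xi>" "0 \<le> t" "i < length ts - 1"
  shows "square_integrable M (\<lambda>w. increment (min t (ts ! i)) (min t (ts ! Suc i)) w *\<^sub>R \<xi> i w)"
proof -
  note si = simple_integrandD[OF assms(1,3)]
  obtain K where "\<forall>w\<in>space M. norm (\<xi> i w) \<le> K" using si(4) by blast
  then show ?thesis
    using si assms(2) by (intro square_integrable_increment_scaleR[of _ _ _ K] adapted_measurable[OF si(3)]) auto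
qed

lemma square_integrable_simple_ito:
  assumes "simple_integrand M W ts \<xi>" "0 \<le> t"
  shows "square_integrable M (simple_ito_integral W ts \<xi> t)"
  unfolding simple_ito_integral_eq[abs_def]
  by (rule square_integrable_sum) (simp add: square_integrable_ito_term[OF assms])

lemma on_interval_simple_process:
  assumes "simple_integrand M W ts \<xi>"
  shows "on_interval t (simple_process ts \<xi>) =
    (\<lambda>p. \<Sum>i<length ts - 1. rectangle (ts ! i) (min t (ts ! Suc i)) (\<xi> i) p)"
proof (rule ext, clarify)
  fix w s
  have "indicator {0..t} s *\<^sub>R indicator {ts ! i<..ts ! Suc i} s *\<^sub>R \<xi> i w
      = rectangle (ts ! i) (min t (ts ! Suc i)) (\<xi> i) (w, s)" if "i < length ts - 1" for i
    using simple_integrandD(1)[OF assms that] by (auto simp: rectangle_def indicator_def)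
  then show "on_interval t (simple_process ts \<xi>) (w, s)
      = (\<Sum>i<length ts - 1. rectangle (ts ! i) (min t (ts ! Suc i)) (\<xi> i) (w, s))"
    unfolding on_interval_def simple_process_def prod.case scaleR_sum_right
    by (intro sum.cong refl) simp
qed

lemma square_integrable_simple_process:
  assumes "simple_integrand M W ts \<xi>"
  shows "square_integrable cylinder (on_interval t (simple_process ts \<xi>))"
  unfolding on_interval_simple_process[OF assms]
  by (rule square_integrable_sum) (simp add: square_integrable_rectangle square_integrable_coefficient[OF assms])

text \<open>The Ito isometry in bilinear form: summand by summand, both sides are the length of the overlap of
  two stopped intervals times the expectation of the inner product of the coefficients.\<close>

lemma simple_ito_isometry:
  assumes \<xi>: "simple_integrand M W ts \<xi>" and \<eta>: "simple_integrand M W us \<eta>" and t: "0 \<le> t"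
  shows "expectation (\<lambda>w. simple_ito_integral W ts \<xi> t w \<bullet> simple_ito_integral W us \<eta> t w)
    = (\<integral>p. on_interval t (simple_process ts \<xi>) p \<bullet> on_interval t (simple_process us \<eta>) p \<partial>cylinder)"
proof -
  let ?I = "\<lambda>i w. increment (min t (ts ! i)) (min t (ts ! Suc i)) w *\<^sub>R \<xi> i w"
  let ?J = "\<lambda>j w. increment (min t (us ! j)) (min t (us ! Suc j)) w *\<^sub>R \<eta> j w"
  let ?P = "\<lambda>i. rectangle (ts ! i) (min t (ts ! Suc i)) (\<xi> i)"
  let ?R = "\<lambda>j. rectangle (us ! j) (min t (us ! Suc j)) (\<eta> j)"
  have summand: "expectation (\<lambda>w. ?I i w \<bullet> ?J j w) = (\<integral>p. ?P i p \<bullet> ?R j p \<partial>cylinder)"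
    if i: "i < length ts - 1" and j: "j < length us - 1" for i j
  proof -
    note d\<xi> = simple_integrandD[OF \<xi> i] and d\<eta> = simple_integrandD[OF \<eta> j]
    obtain K where K: "\<And>w. w \<in> space M \<Longrightarrow> norm (\<xi> i w) \<le> K" using d\<xi>(4) by blast
    obtain L where L: "\<And>w. w \<in> space M \<Longrightarrow> norm (\<eta> j w) \<le> L" using d\<eta>(4) by blast
    show ?thesis
      using expectation_stopped_increment_pair[OF d\<xi>(1) d\<eta>(1) d\<xi>(2) d\<eta>(2) d\<xi>(3) K d\<eta>(3) L, of t]
        integral_rectangle_inner[OF square_integrable_coefficient[OF \<xi> i]
          square_integrable_coefficient[OF \<eta> j]] by simp
  qed
  have "expectation (\<lambda>w. simple_ito_integral W ts \<xi> t w \<bullet> simple_ito_integral W us \<eta> t w)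
      = expectation (\<lambda>w. \<Sum>i<length ts - 1. \<Sum>j<length us - 1. ?I i w \<bullet> ?J j w)"
    by (simp only: simple_ito_integral_eq inner_sum_left) (simp only: inner_sum_right)
  also have "\<dots> = (\<Sum>i<length ts - 1. \<Sum>j<length us - 1. expectation (\<lambda>w. ?I i w \<bullet> ?J j w))"
    by (intro integral_double_sum integrable_inner square_integrable_ito_term[OF \<xi> t]
        square_integrable_ito_term[OF \<eta> t]) simp_all
  also have "\<dots> = (\<Sum>i<length ts - 1. \<Sum>j<length us - 1. \<integral>p. ?P i p \<bullet> ?R j p \<partial>cylinder)"
    by (intro sum.cong refl summand) (simp_all only: lessThan_iff)
  also have "\<dots> = (\<integral>p. (\<Sum>i<length ts - 1. \<Sum>j<length us - 1. ?P i p \<bullet> ?R j p) \<partial>cylinder)"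
    by (intro integral_double_sum[symmetric] integrable_inner square_integrable_rectangle
        square_integrable_coefficient[OF \<xi>] square_integrable_coefficient[OF \<eta>]) simp_all
  also have "\<dots> = (\<integral>p. on_interval t (simple_process ts \<xi>) p \<bullet> on_interval t (simple_process us \<eta>) p \<partial>cylinder)"
    by (simp only: on_interval_simple_process[OF \<xi>] on_interval_simple_process[OF \<eta>] inner_sum_left)
      (simp only: inner_sum_right)
  finally show ?thesis .
qed

text \<open>The part of the integral after time \<open>r\<close> is orthogonal to the past of \<open>r\<close>. Each interval of the partition ends
  before \<open>r\<close>, straddles \<open>r\<close>, starts between \<open>r\<close> and \<open>t\<close>, or starts after \<open>t\<close>.\<close>

lemma simple_ito_martingale:
  fixes Z :: "'w \<Rightarrow> real^'n"
  assumes \<xi>: "simple_integrand M W ts \<xi>" and rt: "0 \<le> r" "r \<le> t"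
    and Z: "Z \<in> borel_measurable (\<F> r)" "square_integrable M Z"
  shows "expectation (\<lambda>w. Z w \<bullet> simple_ito_integral W ts \<xi> t w)
    = expectation (\<lambda>w. Z w \<bullet> simple_ito_integral W ts \<xi> r w)"
proof -
  let ?I = "\<lambda>t i w. increment (min t (ts ! i)) (min t (ts ! Suc i)) w *\<^sub>R \<xi> i w"
  have summand: "expectation (\<lambda>w. Z w \<bullet> ?I t i w) = expectation (\<lambda>w. Z w \<bullet> ?I r i w)"
    if i: "i < length ts - 1" for i
  proof -
    define a b where "a = ts ! i" and "b = ts ! Suc i"
    note d = simple_integrandD[OF \<xi> i, folded a_def b_def]
    obtain K where K: "\<And>w. w \<in> space M \<Longrightarrow> norm (\<xi> i w) \<le> K" using d(4) by blast
    define Y where "Y = (\<lambda>w. Z w \<bullet> \<xi> i w)"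
    have Yint: "integrable M Y"
      unfolding Y_def by (rule integrable_inner[OF Z(2) square_integrable_coefficient[OF \<xi> i]])
    have YI: "integrable M (\<lambda>w. Y w * increment u v w)" if "0 \<le> u" "0 \<le> v" for u v
      using integrable_inner[OF Z(2) square_integrable_increment_scaleR[OF that adapted_measurable[OF d(3)] K]]
      by (simp add: Y_def mult.commute)
    have Yad: "Y \<in> borel_measurable (\<F> (max r a))"
      using adapted_mono[OF _ Z(1), of "max r a"] adapted_mono[OF _ d(3), of "max r a"]
      unfolding Y_def by simp
    consider "b \<le> r" | "a \<le> r" "r \<le> b" | "r \<le> a" "a \<le> t" | "t \<le> a" by linarith
    then have "expectation (\<lambda>w. Y w * increment (min t a) (min t b) w)
        = expectation (\<lambda>w. Y w * increment (min r a) (min r b) w)"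
    proof cases
      case 1
      then have "min t a = min r a" "min t b = min r b" using d rt by auto
      then show ?thesis by simp
    next
      case 2
      then have m: "min t a = a" "min r a = a" "min r b = r" using rt by auto
      have "Y w * increment a (min t b) w = Y w * increment a r w + Y w * increment r (min t b) w" for w
        by (simp add: increment_def algebra_simps)
      moreover have "expectation (\<lambda>w. Y w * increment r (min t b) w) = 0"
        by (rule expectation_increment(2)[OF _ _ _ Yint]) (use Yad 2 rt in \<open>auto simp: max_absorb1\<close>)
      ultimately show ?thesis using YI[of a r] YI[of r "min t b"] m rt 2 d by simp
    next
      case 3
      then have m: "min t a = a" "min r a = r" "min r b = r" using rt d by auto
      have "expectation (\<lambda>w. Y w * increment a (min t b) w) = 0"
        by (rule expectation_increment(2)[OF _ _ _ Yint]) (use Yad 3 d in \<open>auto simp: max_absorb2\<close>)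
      then show ?thesis using m by (simp add: increment_def)
    next
      case 4
      then have "min t a = t" "min t b = t" "min r a = r" "min r b = r" using rt d by auto
      then show ?thesis by (simp add: increment_def)
    qed
    then show ?thesis by (simp add: Y_def a_def b_def mult.commute)
  qed
  have t: "0 \<le> t" using rt by simp
  have "expectation (\<lambda>w. Z w \<bullet> simple_ito_integral W ts \<xi> u w)
      = (\<Sum>i<length ts - 1. expectation (\<lambda>w. Z w \<bullet> ?I u i w))" if "0 \<le> u" for u
    unfolding simple_ito_integral_eq inner_sum_right
    by (intro Bochner_Integration.integral_sum integrable_inner Z(2) square_integrable_ito_term[OF \<xi> that]) simp
  then show ?thesis using rt t summand by simp
qed

end

section \<open>Ito integrals as mean square limits\<close>

context brownian
begin

lemma simple_ito_isometry_diff: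
  assumes \<xi>: "simple_integrand M W ts \<xi>" and \<eta>: "simple_integrand M W us \<eta>" and t: "0 \<le> t"
  shows "expectation (\<lambda>w. (norm (simple_ito_integral W ts \<xi> t w - simple_ito_integral W us \<eta> t w))\<^sup>2)
    = (\<integral>p. (norm (on_interval t (simple_process ts \<xi>) p - on_interval t (simple_process us \<eta>) p))\<^sup>2 \<partial>cylinder)"
proof -
  have expand: "(\<integral>x. (norm (X x - Y x))\<^sup>2 \<partial>N) = (\<integral>x. X x \<bullet> X x \<partial>N) - 2 * (\<integral>x. X x \<bullet> Y x \<partial>N) + (\<integral>x. Y x \<bullet> Y x \<partial>N)"
    if "square_integrable N X" "square_integrable N Y" for N :: "'x measure" and X Y :: "'x \<Rightarrow> real^'n"
  proof -
    have "(\<integral>x. (norm (X x - Y x))\<^sup>2 \<partial>N) = (\<integral>x. X x \<bullet> X x - 2 * (X x \<bullet> Y x) + Y x \<bullet> Y x \<partial>N)"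
      by (intro Bochner_Integration.integral_cong refl)
        (simp add: power2_norm_eq_inner inner_diff_left inner_diff_right inner_commute)
    also have "\<dots> = (\<integral>x. X x \<bullet> X x \<partial>N) - 2 * (\<integral>x. X x \<bullet> Y x \<partial>N) + (\<integral>x. Y x \<bullet> Y x \<partial>N)"
      using integrable_inner[OF that(1) that(1)] integrable_inner[OF that] integrable_inner[OF that(2) that(2)]
      by simp
    finally show ?thesis .
  qed
  show ?thesis
    using expand[OF square_integrable_simple_ito[OF \<xi> t] square_integrable_simple_ito[OF \<eta> t]]
      expand[OF square_integrable_simple_process[OF \<xi>] square_integrable_simple_process[OF \<eta>], of t t]
      simple_ito_isometry[OF \<xi> \<xi> t] simple_ito_isometry[OF \<xi> \<eta> t] simple_ito_isometry[OF \<eta> \<eta> t]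
    by (simp only:)
qed

text \<open>The approximating simple integrands from the definition of the Ito integral, with their convergence
  expressed in the \<open>L\<^sup>2\<close> spaces of the product measure and of the probability space.\<close>

lemma ito_approximation:
  fixes h :: "real \<Rightarrow> 'w \<Rightarrow> real^'n"
  assumes ito: "has_ito_integral M W h t I" and t: "0 \<le> t"
    and meas: "on_interval t h \<in> borel_measurable cylinder"
  obtains ts \<xi> where "\<forall>k::nat. simple_integrand M W (ts k) (\<xi> k)"
    and "(\<lambda>k. \<integral>p. (norm (on_interval t (simple_process (ts k) (\<xi> k)) p - on_interval t h p))\<^sup>2 \<partial>cylinder)
      \<longlonglongrightarrow> 0"
    and "(\<lambda>k. expectation (\<lambda>w. (norm (simple_ito_integral W (ts k) (\<xi> k) t w - I w))\<^sup>2)) \<longlonglongrightarrow> 0"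
    and "square_integrable M I" "square_integrable cylinder (on_interval t h)"
proof -
  obtain ts \<xi> where simple: "\<And>k::nat. simple_integrand M W (ts k) (\<xi> k)"
    and h: "(\<lambda>k. \<integral>\<^sup>+w. (\<integral>\<^sup>+s\<in>{0..t}. ennreal ((norm (h s w - simple_process (ts k) (\<xi> k) s w))\<^sup>2) \<partial>lborel) \<partial>M) \<longlonglongrightarrow> 0"
    and I: "(\<lambda>k. \<integral>\<^sup>+w. ennreal ((norm (simple_ito_integral W (ts k) (\<xi> k) t w - I w))\<^sup>2) \<partial>M) \<longlonglongrightarrow> 0"
    and "I \<in> borel_measurable M"
    using ito unfolding has_ito_integral_def by blast
  have "(\<integral>\<^sup>+w. (\<integral>\<^sup>+s\<in>{0..t}. ennreal ((norm (h s w - simple_process (ts k) (\<xi> k) s w))\<^sup>2) \<partial>lborel) \<partial>M)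
      = (\<integral>\<^sup>+p. ennreal ((norm (on_interval t (simple_process (ts k) (\<xi> k)) p - on_interval t h p))\<^sup>2) \<partial>cylinder)" for k
  proof -
    have [measurable]: "on_interval t (simple_process (ts k) (\<xi> k)) \<in> borel_measurable cylinder"
      by (rule square_integrable_measurable[OF square_integrable_simple_process[OF simple]])
    note meas[measurable]
    have "(\<integral>\<^sup>+w. (\<integral>\<^sup>+s\<in>{0..t}. ennreal ((norm (h s w - simple_process (ts k) (\<xi> k) s w))\<^sup>2) \<partial>lborel) \<partial>M)
      = (\<integral>\<^sup>+w. \<integral>\<^sup>+s. ennreal ((norm (on_interval t (simple_process (ts k) (\<xi> k)) (w, s) - on_interval t h (w, s)))\<^sup>2) \<partial>lborel \<partial>M)"
      by (intro nn_integral_cong) (simp add: on_interval_def indicator_def norm_minus_commute)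
    also have "\<dots> = (\<integral>\<^sup>+p. ennreal ((norm (on_interval t (simple_process (ts k) (\<xi> k)) p - on_interval t h p))\<^sup>2) \<partial>cylinder)"
      by (rule lborel.nn_integral_fst) measurable
    finally show ?thesis .
  qed
  with h have h': "(\<lambda>k. \<integral>\<^sup>+p. ennreal ((norm (on_interval t (simple_process (ts k) (\<xi> k)) p - on_interval t h p))\<^sup>2) \<partial>cylinder) \<longlonglongrightarrow> 0"
    by (simp only:)
  show ?thesis
    using that[OF allI[OF simple] mean_square_limit(2)[OF square_integrable_simple_process[OF simple] meas h']
        mean_square_limit(2)[OF square_integrable_simple_ito[OF simple t] \<open>I \<in> borel_measurable M\<close> I]
        mean_square_limit(1)[OF square_integrable_simple_ito[OF simple t] \<open>I \<in> borel_measurable M\<close> I]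
        mean_square_limit(1)[OF square_integrable_simple_process[OF simple] meas h']] .
qed

lemma simple_integrand_matrix:
  fixes G :: "real^'n^'m"
  assumes "simple_integrand M W ts \<xi>"
  shows "simple_integrand M W ts (\<lambda>i w. G *v \<xi> i w)"
proof -
  have "(*v) G \<in> borel_measurable borel"
    by (intro borel_measurable_continuous_onI linear_continuous_on matrix_vector_mul_bounded_linear)
  note meas = measurable_compose[OF _ this]
  obtain K where K: "\<And>x. norm (G *v x) \<le> norm x * K" "0 \<le> K"
    using bounded_linear.nonneg_bounded[OF matrix_vector_mul_bounded_linear, of G] by blast
  have "\<exists>c. \<forall>w\<in>space M. norm (G *v \<xi> i w) \<le> c" if "\<forall>w\<in>space M. norm (\<xi> i w) \<le> c" for i c
    using that K order_trans[OF K(1) mult_right_mono[OF _ K(2)]] by blast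
  then show ?thesis
    using assms meas unfolding simple_integrand_def by blast
qed

lemma simple_ito_integral_matrix:
  "simple_ito_integral W ts (\<lambda>i w. G *v \<xi> i w) t w = G *v simple_ito_integral W ts \<xi> t w"
  by (simp add: simple_ito_integral_def matrix_vector_mult_scaleR
      linear_sum[OF matrix_vector_mul_linear])

lemma on_interval_simple_process_matrix:
  "on_interval t (simple_process ts (\<lambda>i w. G *v \<xi> i w)) p = G *v on_interval t (simple_process ts \<xi>) p"
  by (simp add: on_interval_def simple_process_def matrix_vector_mult_scaleR split_beta
      linear_sum[OF matrix_vector_mul_linear])

text \<open>The isometry for the quadratic form of an arbitrary matrix, which is what the second moments of a
  solution require. For simple integrands it is the bilinear isometry, because \<open>\<Delta>\<close> applied to the
  coefficients is again a simple integrand.\<close>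

lemma ito_isometry:
  fixes h :: "real \<Rightarrow> 'w \<Rightarrow> real^'n" and \<Delta> :: "real^'n^'n"
  assumes ito: "has_ito_integral M W h t I" and t: "0 \<le> t"
    and meas: "on_interval t h \<in> borel_measurable cylinder"
  shows "expectation (\<lambda>w. I w \<bullet> (\<Delta> *v I w)) = (\<integral>p. on_interval t h p \<bullet> (\<Delta> *v on_interval t h p) \<partial>cylinder)"
proof -
  obtain ts \<xi> where approx: "\<forall>k::nat. simple_integrand M W (ts k) (\<xi> k)"
    and lh: "(\<lambda>k. \<integral>p. (norm (on_interval t (simple_process (ts k) (\<xi> k)) p - on_interval t h p))\<^sup>2 \<partial>cylinder) \<longlonglongrightarrow> 0"
    and lI: "(\<lambda>k. expectation (\<lambda>w. (norm (simple_ito_integral W (ts k) (\<xi> k) t w - I w))\<^sup>2)) \<longlonglongrightarrow> 0"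
    and sI: "square_integrable M I" and sh: "square_integrable cylinder (on_interval t h)"
    by (rule ito_approximation[OF assms])
  note simple = spec[OF approx]
  note si = square_integrable_simple_ito[OF simple t] and sp = square_integrable_simple_process[OF simple]
  have "(\<lambda>k. expectation (\<lambda>w. simple_ito_integral W (ts k) (\<xi> k) t w \<bullet> (\<Delta> *v simple_ito_integral W (ts k) (\<xi> k) t w)))
      \<longlonglongrightarrow> expectation (\<lambda>w. I w \<bullet> (\<Delta> *v I w))"
    by (rule tendsto_integral_inner[OF si sI square_integrable_matrix[OF si] square_integrable_matrix[OF sI]
        lI mean_square_limit_matrix[OF si sI lI]])
  moreover have "(\<lambda>k. \<integral>p. on_interval t (simple_process (ts k) (\<xi> k)) p \<bullet> (\<Delta> *v on_interval t (simple_process (ts k) (\<xi> k)) p) \<partial>cylinder)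
      \<longlonglongrightarrow> (\<integral>p. on_interval t h p \<bullet> (\<Delta> *v on_interval t h p) \<partial>cylinder)"
    by (rule tendsto_integral_inner[OF sp sh square_integrable_matrix[OF sp] square_integrable_matrix[OF sh]
        lh mean_square_limit_matrix[OF sp sh lh]])
  moreover have "expectation (\<lambda>w. simple_ito_integral W (ts k) (\<xi> k) t w \<bullet> (\<Delta> *v simple_ito_integral W (ts k) (\<xi> k) t w))
      = (\<integral>p. on_interval t (simple_process (ts k) (\<xi> k)) p \<bullet> (\<Delta> *v on_interval t (simple_process (ts k) (\<xi> k)) p) \<partial>cylinder)" for k
    using simple_ito_isometry[OF simple[of k] simple_integrand_matrix[OF simple[of k], of \<Delta>] t]
    by (simp only: simple_ito_integral_matrix on_interval_simple_process_matrix)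
  ultimately show ?thesis by (simp only:) (rule LIMSEQ_unique)
qed

lemma tendsto_expectation_inner:
  fixes X :: "nat \<Rightarrow> 'w \<Rightarrow> real^'n"
  assumes "\<And>k. square_integrable M (X k)" "square_integrable M Y" "square_integrable M Z"
    and "(\<lambda>k. expectation (\<lambda>w. (norm (X k w - Y w))\<^sup>2)) \<longlonglongrightarrow> 0"
  shows "(\<lambda>k. expectation (\<lambda>w. Z w \<bullet> X k w)) \<longlonglongrightarrow> expectation (\<lambda>w. Z w \<bullet> Y w)"
  by (rule tendsto_integral_inner[OF assms(3,3,1,2) _ assms(4)]) simp

lemma ito_expectation_zero:
  fixes h :: "real \<Rightarrow> 'w \<Rightarrow> real^'n"
  assumes ito: "has_ito_integral M W h t I" and t: "0 \<le> t"
    and meas: "on_interval t h \<in> borel_measurable cylinder"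
  shows "expectation (\<lambda>w. z \<bullet> I w) = 0"
proof -
  obtain ts \<xi> where approx: "\<forall>k::nat. simple_integrand M W (ts k) (\<xi> k)"
    and lI: "(\<lambda>k. expectation (\<lambda>w. (norm (simple_ito_integral W (ts k) (\<xi> k) t w - I w))\<^sup>2)) \<longlonglongrightarrow> 0"
    and sI: "square_integrable M I"
    using ito_approximation[OF assms] by blast
  note simple = spec[OF approx]
  have z: "square_integrable M (\<lambda>w. z)" by (simp add: square_integrable_def)
  \<comment> \<open>All intervals stopped at time \<open>0\<close> are degenerate.\<close>
  have "simple_ito_integral W (ts k) (\<xi> k) 0 w = 0" for k w
    unfolding simple_ito_integral_eq
  proof (rule sum.neutral, rule ballI)
    fix i assume "i \<in> {..<length (ts k) - 1}"
    then have "min 0 (ts k ! i) = 0" "min 0 (ts k ! Suc i) = 0"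
      using simple_integrandD(1,2)[OF simple[of k], of i] by simp_all
    then show "increment (min 0 (ts k ! i)) (min 0 (ts k ! Suc i)) w *\<^sub>R \<xi> k i w = 0"
      by (simp add: increment_def)
  qed
  then have "expectation (\<lambda>w. z \<bullet> simple_ito_integral W (ts k) (\<xi> k) t w) = 0" for k
    using simple_ito_martingale[OF simple order_refl t _ z, of k] by simp
  moreover have "(\<lambda>k. expectation (\<lambda>w. z \<bullet> simple_ito_integral W (ts k) (\<xi> k) t w)) \<longlonglongrightarrow> expectation (\<lambda>w. z \<bullet> I w)"
    by (rule tendsto_expectation_inner[OF square_integrable_simple_ito[OF simple t] sI z lI])
  ultimately show ?thesis by (simp add: LIMSEQ_const_iff)
qed

text \<open>The integrals up to \<open>r\<close> and up to \<open>t\<close> are defined by unrelated approximating sequences. By the isometry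
  the integrals up to \<open>r\<close> of both sequences have the same mean square limit, so the martingale property
  of simple integrals passes to the limit.\<close>

lemma ito_martingale:
  fixes h :: "real \<Rightarrow> 'w \<Rightarrow> real^'n"
  assumes I: "has_ito_integral M W h t I" and J: "has_ito_integral M W h r J" and rt: "0 \<le> r" "r \<le> t"
    and meas: "on_interval t h \<in> borel_measurable cylinder" "on_interval r h \<in> borel_measurable cylinder"
    and Z: "Z \<in> borel_measurable (\<F> r)" "square_integrable M Z"
  shows "expectation (\<lambda>w. Z w \<bullet> I w) = expectation (\<lambda>w. Z w \<bullet> J w)"
proof -
  have t: "0 \<le> t" using rt by simp
  obtain ts \<xi> where approx_t: "\<forall>k::nat. simple_integrand M W (ts k) (\<xi> k)"
    and lht: "(\<lambda>k. \<integral>p. (norm (on_interval t (simple_process (ts k) (\<xi> k)) p - on_interval t h p))\<^sup>2 \<partial>cylinder) \<longlonglongrightarrow> 0"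
    and lI: "(\<lambda>k. expectation (\<lambda>w. (norm (simple_ito_integral W (ts k) (\<xi> k) t w - I w))\<^sup>2)) \<longlonglongrightarrow> 0"
    and sI: "square_integrable M I" and sht: "square_integrable cylinder (on_interval t h)"
    by (rule ito_approximation[OF I t meas(1)])
  obtain us \<eta> where approx_r: "\<forall>k::nat. simple_integrand M W (us k) (\<eta> k)"
    and lhr: "(\<lambda>k. \<integral>p. (norm (on_interval r (simple_process (us k) (\<eta> k)) p - on_interval r h p))\<^sup>2 \<partial>cylinder) \<longlonglongrightarrow> 0"
    and lJ: "(\<lambda>k. expectation (\<lambda>w. (norm (simple_ito_integral W (us k) (\<eta> k) r w - J w))\<^sup>2)) \<longlonglongrightarrow> 0"
    and sJ: "square_integrable M J" and shr: "square_integrable cylinder (on_interval r h)"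
    by (rule ito_approximation[OF J rt(1) meas(2)])
  note \<xi> = spec[OF approx_t] and \<eta> = spec[OF approx_r]
  note si\<xi> = square_integrable_simple_ito[OF \<xi>] and sp\<xi> = square_integrable_simple_process[OF \<xi>]
  note si\<eta> = square_integrable_simple_ito[OF \<eta>] and sp\<eta> = square_integrable_simple_process[OF \<eta>]
  \<comment> \<open>The integrands that approximate \<open>h\<close> up to time \<open>t\<close> also approximate it up to time \<open>r\<close>.\<close>
  have bound: "\<bar>\<integral>p. (norm (on_interval r (simple_process (ts k) (\<xi> k)) p - on_interval r h p))\<^sup>2 \<partial>cylinder\<bar>
      \<le> (\<integral>p. (norm (on_interval t (simple_process (ts k) (\<xi> k)) p - on_interval t h p))\<^sup>2 \<partial>cylinder)" for k
  proof -
    have "(norm (on_interval r (simple_process (ts k) (\<xi> k)) p - on_interval r h p))\<^sup>2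
        \<le> (norm (on_interval t (simple_process (ts k) (\<xi> k)) p - on_interval t h p))\<^sup>2" for p
      using rt by (simp add: on_interval_def split_beta indicator_def)
    then have "(\<integral>p. (norm (on_interval r (simple_process (ts k) (\<xi> k)) p - on_interval r h p))\<^sup>2 \<partial>cylinder)
      \<le> (\<integral>p. (norm (on_interval t (simple_process (ts k) (\<xi> k)) p - on_interval t h p))\<^sup>2 \<partial>cylinder)"
      using square_integrable_diff[OF sp\<xi>[of r k] shr] square_integrable_diff[OF sp\<xi>[of t k] sht]
      by (intro integral_mono) (simp_all add: square_integrable_def)
    then show ?thesis by (subst abs_of_nonneg) simp_all
  qed
  note lh = null_sequence_comparison[OF bound lht]
  have lhr': "(\<lambda>k. \<integral>p. (norm (on_interval r h p - on_interval r (simple_process (us k) (\<eta> k)) p))\<^sup>2 \<partial>cylinder) \<longlonglongrightarrow> 0"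
    using lhr by (simp add: norm_minus_commute)
  have "(\<lambda>k. \<integral>p. (norm (on_interval r (simple_process (ts k) (\<xi> k)) p - on_interval r (simple_process (us k) (\<eta> k)) p))\<^sup>2 \<partial>cylinder) \<longlonglongrightarrow> 0"
    by (rule mean_square_null_trans[OF _ _ _ lh lhr']) (rule sp\<xi> shr sp\<eta>)+
  then have lIJ: "(\<lambda>k. expectation (\<lambda>w. (norm (simple_ito_integral W (ts k) (\<xi> k) r w - simple_ito_integral W (us k) (\<eta> k) r w))\<^sup>2)) \<longlonglongrightarrow> 0"
    by (simp only: simple_ito_isometry_diff[OF \<xi> \<eta> rt(1)])
  have "(\<lambda>k. expectation (\<lambda>w. (norm (simple_ito_integral W (ts k) (\<xi> k) r w - J w))\<^sup>2)) \<longlonglongrightarrow> 0"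
    by (rule mean_square_null_trans[OF _ _ _ lIJ lJ]) (rule si\<xi>[OF rt(1)] si\<eta>[OF rt(1)] sJ)+
  from tendsto_expectation_inner[OF si\<xi>[OF rt(1)] sJ Z(2) this]
  have "(\<lambda>k. expectation (\<lambda>w. Z w \<bullet> simple_ito_integral W (ts k) (\<xi> k) t w)) \<longlonglongrightarrow> expectation (\<lambda>w. Z w \<bullet> J w)"
    unfolding simple_ito_martingale[OF \<xi> rt Z] .
  with tendsto_expectation_inner[OF si\<xi>[OF t] sI Z(2) lI] show ?thesis by (rule LIMSEQ_unique)
qed

end

section \<open>Solutions with continuous paths\<close>

lemma floor_grid_limit:
  fixes s :: real
  shows "(\<lambda>n. real_of_int \<lfloor>s * real (Suc n)\<rfloor> / real (Suc n)) \<longlonglongrightarrow> s"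
proof -
  have "\<bar>real_of_int \<lfloor>s * real (Suc n)\<rfloor> / real (Suc n) - s\<bar> \<le> inverse (real (Suc n))" for n
  proof -
    have "real_of_int \<lfloor>s * real (Suc n)\<rfloor> / real (Suc n) - s
        = (real_of_int \<lfloor>s * real (Suc n)\<rfloor> - s * real (Suc n)) * inverse (real (Suc n))"
      by (simp add: field_simps)
    moreover have "\<bar>real_of_int \<lfloor>s * real (Suc n)\<rfloor> - s * real (Suc n)\<bar> \<le> 1" by linarith
    ultimately show ?thesis
      by (simp add: abs_mult mult_left_le_one_le del: of_nat_Suc)
  qed
  then have "(\<lambda>n. real_of_int \<lfloor>s * real (Suc n)\<rfloor> / real (Suc n) - s) \<longlonglongrightarrow> 0"
    using LIMSEQ_inverse_real_of_nat by (rule null_sequence_comparison)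
  then show ?thesis by (rule LIM_zero_cancel)
qed

text \<open>A process with continuous paths is jointly measurable: at each time it is the limit
  of its values at nearby times of finer and finer grids, and each grid is countable.\<close>

lemma on_interval_measurable:
  fixes x :: "real \<Rightarrow> 'w \<Rightarrow> 'b::euclidean_space"
  assumes T: "0 \<le> T" and x: "\<And>t. 0 \<le> t \<Longrightarrow> t \<le> T \<Longrightarrow> x t \<in> borel_measurable M"
    and cont: "\<And>w. w \<in> space M \<Longrightarrow> continuous_on {0..T} (\<lambda>t. x t w)"
  shows "on_interval T x \<in> borel_measurable (M \<Otimes>\<^sub>M (lborel :: real measure))"
proof -
  \<comment> \<open>Clipping the time at both ends keeps the grid points inside \<open>{0..T}\<close>, where the process is known to be
    measurable and continuous.\<close>
  define clip :: "real \<Rightarrow> real" where "clip s = max 0 (min T s)" for s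
  have clip: "0 \<le> clip s" "clip s \<le> T" for s using T by (auto simp: clip_def)
  have [measurable]: "x (clip s) \<in> borel_measurable M" for s using x clip by simp
  have "(\<lambda>p. x (clip (snd p)) (fst p)) \<in> borel_measurable (M \<Otimes>\<^sub>M (lborel :: real measure))"
  proof (rule borel_measurable_LIMSEQ_metric)
    show "(\<lambda>p. x (clip (real_of_int \<lfloor>snd p * real (Suc n)\<rfloor> / real (Suc n))) (fst p))
        \<in> borel_measurable (M \<Otimes>\<^sub>M (lborel :: real measure))" for n
      by (rule measurable_compose_countable[where f="\<lambda>i p. x (clip (real_of_int i / real (Suc n))) (fst p)"
            and g="\<lambda>p. \<lfloor>snd p * real (Suc n)\<rfloor>"]) measurable
    fix p assume p: "p \<in> space (M \<Otimes>\<^sub>M (lborel :: real measure))"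
    have "continuous_on UNIV (\<lambda>s. x (clip s) (fst p))"
    proof (rule continuous_on_compose2[of "{0..T}" "\<lambda>t. x t (fst p)"])
      show "continuous_on {0..T} (\<lambda>t. x t (fst p))" using cont p by (auto simp: space_pair_measure)
      show "continuous_on UNIV clip" unfolding clip_def[abs_def] by (intro continuous_intros)
    qed (use clip in auto)
    then show "(\<lambda>n. x (clip (real_of_int \<lfloor>snd p * real (Suc n)\<rfloor> / real (Suc n))) (fst p))
        \<longlonglongrightarrow> x (clip (snd p)) (fst p)"
      by (rule continuous_on_tendsto_compose[OF _ floor_grid_limit]) simp_all
  qed
  note this[measurable]
  have "on_interval T x = (\<lambda>p. indicator {0..T} (snd p) *\<^sub>R x (clip (snd p)) (fst p))"
    by (auto simp: on_interval_def fun_eq_iff indicator_def clip_def)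
  also have "\<dots> \<in> borel_measurable (M \<Otimes>\<^sub>M (lborel :: real measure))" by measurable
  finally show ?thesis .
qed

context brownian
begin

text \<open>A rectangle that starts at \<open>-1\<close> dominates the process, whose time interval is closed at \<open>0\<close>.\<close>

lemma square_integrable_on_interval_const:
  fixes X :: "'w \<Rightarrow> 'b::euclidean_space"
  assumes "square_integrable M X"
  shows "square_integrable cylinder (on_interval t (\<lambda>s. X))"
proof (rule square_integrable_dominated[OF square_integrable_rectangle[OF assms], of _ 1])
  have [measurable]: "X \<in> borel_measurable M" using assms by (rule square_integrable_measurable)
  show "on_interval t (\<lambda>s. X) \<in> borel_measurable cylinder"
    unfolding on_interval_def by measurable
  show "norm (on_interval t (\<lambda>s. X) p) \<le> 1 * norm (rectangle (-1) t X p)" for p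
    by (simp add: on_interval_def rectangle_def split_beta indicator_def)
qed

lemma has_ito_integral_cong:
  assumes "has_ito_integral M W h t I" and eq: "AE w in M. \<forall>s\<in>{0..t}. h s w = h' s w"
  shows "has_ito_integral M W h' t I"
proof -
  have "(\<integral>\<^sup>+w. (\<integral>\<^sup>+s\<in>{0..t}. ennreal ((norm (h s w - f s w))\<^sup>2) \<partial>lborel) \<partial>M)
      = (\<integral>\<^sup>+w. (\<integral>\<^sup>+s\<in>{0..t}. ennreal ((norm (h' s w - f s w))\<^sup>2) \<partial>lborel) \<partial>M)" for f
    using eq by (intro nn_integral_cong_AE, eventually_elim)
      (auto intro!: nn_integral_cong simp: indicator_def)
  then show ?thesis using assms(1) unfolding has_ito_integral_def by (simp only:)
qed

lemma sde_solution_cong: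
  assumes sol: "sde_solution M W F G x0 x"
    and eq: "AE w in M. \<forall>t\<ge>0. x t w = x' t w"
    and ad: "\<And>t. 0 \<le> t \<Longrightarrow> x' t \<in> borel_measurable (\<F> t)"
  shows "sde_solution M W F G x0 x'"
  unfolding sde_solution_def
proof (intro conjI allI impI)
  note sol = sol[unfolded sde_solution_def]
  show "x' t \<in> borel_measurable (\<F> t)" if "t \<ge> 0" for t by (rule ad[OF that])
  have "AE w in M. continuous_on {0..} (\<lambda>t. x t w)" using sol by blast
  with eq show "AE w in M. continuous_on {0..} (\<lambda>t. x' t w)"
  proof eventually_elim
    case (elim w)
    then show ?case by (subst continuous_on_cong[OF refl, of _ _ "\<lambda>t. x t w"]) simp_all
  qed
  show "integrable M (\<lambda>w. (norm (x' t w))\<^sup>2)" if t: "t \<ge> 0" for t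
  proof -
    have "AE w in M. (norm (x t w))\<^sup>2 = (norm (x' t w))\<^sup>2" using eq by eventually_elim (use t in simp)
    moreover have "x t \<in> borel_measurable M" using sol t adapted_measurable by blast
    ultimately show ?thesis
      using sol t adapted_measurable[OF ad[OF t]]
        integrable_cong_AE[of "\<lambda>w. (norm (x t w))\<^sup>2" M "\<lambda>w. (norm (x' t w))\<^sup>2"] by simp
  qed
  show "(\<integral>\<^sup>+w. (\<integral>\<^sup>+s\<in>{0..t}. ennreal ((norm (x' s w))\<^sup>2) \<partial>lborel) \<partial>M) < \<infinity>" if t: "t \<ge> 0" for t
  proof -
    have "(\<integral>\<^sup>+w. (\<integral>\<^sup>+s\<in>{0..t}. ennreal ((norm (x' s w))\<^sup>2) \<partial>lborel) \<partial>M)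
      = (\<integral>\<^sup>+w. (\<integral>\<^sup>+s\<in>{0..t}. ennreal ((norm (x s w))\<^sup>2) \<partial>lborel) \<partial>M)"
      using eq by (intro nn_integral_cong_AE, eventually_elim)
        (auto intro!: nn_integral_cong simp: indicator_def)
    also have "\<dots> < \<infinity>" using sol t by blast
    finally show ?thesis .
  qed
  show "\<exists>I. has_ito_integral M W (\<lambda>s w. G *v x' s w) t I \<and>
      (AE w in M. x' t w = x0 + integral {0..t} (\<lambda>s. F *v x' s w) + I w)" if t: "t \<ge> 0" for t
  proof -
    obtain I where I: "has_ito_integral M W (\<lambda>s w. G *v x s w) t I"
      and eqI: "AE w in M. x t w = x0 + integral {0..t} (\<lambda>s. F *v x s w) + I w"
      using sol t by blast
    have "has_ito_integral M W (\<lambda>s w. G *v x' s w) t I"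
      by (rule has_ito_integral_cong[OF I]) (use eq in \<open>eventually_elim, simp\<close>)
    moreover have "AE w in M. x' t w = x0 + integral {0..t} (\<lambda>s. F *v x' s w) + I w"
      using eqI eq
    proof eventually_elim
      case (elim w)
      have "integral {0..t} (\<lambda>s. F *v x s w) = integral {0..t} (\<lambda>s. F *v x' s w)"
        by (rule Henstock_Kurzweil_Integration.integral_cong) (use elim(2) in simp)
      then show ?case using elim t by simp
    qed
    ultimately show ?thesis by blast
  qed
qed

text \<open>Solutions have continuous paths only almost surely. Setting the process to zero on the exceptional
  null set keeps it adapted, because the augmented filtration contains the null sets.\<close>

lemma continuous_solution:
  assumes sol: "sde_solution M W F G x0 x"
  obtains x' where "sde_solution M W F G x0 x'"
    and "\<forall>w\<in>space M. continuous_on {0..} (\<lambda>t. x' t w)"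
proof -
  have "AE w in M. continuous_on {0..} (\<lambda>t. x t w)" using sol by (simp add: sde_solution_def)
  then obtain N where N: "{w \<in> space M. \<not> continuous_on {0..} (\<lambda>t. x t w)} \<subseteq> N"
    "N \<in> null_sets M" by (auto elim!: AE_E simp: null_sets_def)
  define x' where "x' t w = (if w \<in> N then 0 else x t w)" for t w
  have "sde_solution M W F G x0 x'"
  proof (rule sde_solution_cong[OF sol])
    show "AE w in M. \<forall>t\<ge>0. x t w = x' t w"
      using AE_not_in[OF N(2)] by eventually_elim (simp add: x'_def)
    show "x' t \<in> borel_measurable (\<F> t)" if "0 \<le> t" for t
    proof -
      have "N \<in> sets (\<F> t)" unfolding sets_filtration using N(2) by (intro sigma_sets.Basic) simp
      moreover have "x t \<in> borel_measurable (\<F> t)" using sol that by (simp add: sde_solution_def)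
      ultimately show ?thesis unfolding x'_def by measurable
    qed
  qed
  moreover have "continuous_on {0..} (\<lambda>t. x' t w)" if "w \<in> space M" for w
    using N(1) that by (cases "w \<in> N") (auto simp: x'_def)
  ultimately show ?thesis using that by blast
qed

end

section \<open>Second moments of solutions\<close>

lemma path_integral:
  fixes y :: "real \<Rightarrow> 'w \<Rightarrow> 'b::euclidean_space"
  assumes "continuous_on {0..T} (\<lambda>s. y s w)" and "r \<le> T"
  shows "integrable lborel (\<lambda>s. on_interval r y (w, s))"
    and "integral {0..r} (\<lambda>s. y s w) = (\<integral>s. on_interval r y (w, s) \<partial>lborel)"
proof -
  have "continuous_on {0..r} (\<lambda>s. y s w)"
    using assms by (auto intro: continuous_on_subset)
  then have si: "set_integrable lborel {0..r} (\<lambda>s. y s w)" by (rule borel_integrable_atLeastAtMost')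
  then show "integrable lborel (\<lambda>s. on_interval r y (w, s))"
    by (simp add: set_integrable_def on_interval_def)
  show "integral {0..r} (\<lambda>s. y s w) = (\<integral>s. on_interval r y (w, s) \<partial>lborel)"
    using set_borel_integral_eq_integral(2)[OF si]
    by (simp add: set_lebesgue_integral_def on_interval_def)
qed

context brownian
begin

text \<open>By the Cauchy-Schwarz inequality in time, all the drift integrals up to \<open>T\<close> are dominated by a single
  square integrable random variable, the integral of the norm of the integrand.\<close>

lemma time_integral_square_integrable:
  fixes y :: "real \<Rightarrow> 'w \<Rightarrow> 'b::euclidean_space" and z :: 'b
  assumes T: "0 \<le> T"
    and meas: "\<And>r. 0 \<le> r \<Longrightarrow> on_interval r y \<in> borel_measurable cylinder"
    and cont: "\<And>w. w \<in> space M \<Longrightarrow> continuous_on {0..T} (\<lambda>s. y s w)"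
    and sq: "square_integrable cylinder (on_interval T y)"
  defines "K \<equiv> \<lambda>r w. z + integral {0..r} (\<lambda>s. y s w)"
  shows "\<And>w. w \<in> space M \<Longrightarrow> continuous_on {0..T} (\<lambda>r. K r w)"
    and "\<And>r. 0 \<le> r \<Longrightarrow> r \<le> T \<Longrightarrow> square_integrable M (K r)"
    and "square_integrable cylinder (on_interval T K)"
proof -
  note meas[measurable]
  show Kcont: "continuous_on {0..T} (\<lambda>r. K r w)" if "w \<in> space M" for w
    unfolding K_def
    by (intro continuous_on_add continuous_on_const indefinite_integral_continuous_1
        integrable_continuous_real cont[OF that])
  have Kmeas: "K r \<in> borel_measurable M" if r: "0 \<le> r" "r \<le> T" for r
  proof -
    note meas[OF r(1), measurable]
    have "(\<lambda>w. z + (\<integral>s. on_interval r y (w, s) \<partial>lborel)) \<in> borel_measurable M"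
      by measurable
    then show ?thesis
      by (subst measurable_cong[where g="\<lambda>w. z + (\<integral>s. on_interval r y (w, s) \<partial>lborel)"])
        (use path_integral(2)[where y=y, OF cont r(2)] in \<open>simp_all add: K_def\<close>)
  qed
  \<comment> \<open>\<open>V\<close> dominates the drift integrals up to \<open>T\<close>, and \<open>U\<close> controls its square.\<close>
  define V where "V w = (\<integral>s. norm (on_interval T y (w, s)) \<partial>lborel)" for w
  define U where "U w = (\<integral>s. (norm (on_interval T y (w, s)))\<^sup>2 \<partial>lborel)" for w
  note meas[OF T, measurable]
  have Vmeas: "V \<in> borel_measurable M" unfolding V_def[abs_def] by measurable
  have Uint: "integrable M U"
    unfolding U_def[abs_def] using sq by (intro cylinder.integrable_fst') (simp add: square_integrable_def)
  have VU: "(V w)\<^sup>2 \<le> T * U w" if w: "w \<in> space M" for w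
  proof -
    have "continuous_on {0..T} (\<lambda>s. (norm (y s w))\<^sup>2)" by (intro continuous_intros cont[OF w])
    then have "integrable lborel (\<lambda>s. indicator {0..T} s *\<^sub>R (norm (y s w))\<^sup>2)"
      using borel_integrable_atLeastAtMost' unfolding set_integrable_def by blast
    moreover have "(\<lambda>s. indicator {0..T} s *\<^sub>R (norm (y s w))\<^sup>2) = (\<lambda>s. (norm (on_interval T y (w, s)))\<^sup>2)"
      by (auto simp: on_interval_def indicator_def fun_eq_iff)
    ultimately have i: "integrable lborel (\<lambda>s. (norm (on_interval T y (w, s)))\<^sup>2)" by (simp only:)
    have Y: "square_integrable lborel (\<lambda>s. norm (on_interval T y (w, s)))"
      using i path_integral(1)[where r=T and y=y, OF cont[OF w] order_refl]
      by (simp add: square_integrable_def borel_measurable_integrable)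
    have X: "square_integrable lborel (\<lambda>s. indicator {0..T} s :: real)"
    proof -
      have "(\<lambda>s. (norm (indicator {0..T} s :: real))\<^sup>2) = indicator {0..T}"
        by (auto simp: indicator_def fun_eq_iff)
      moreover have "integrable lborel (indicator {0..T} :: real \<Rightarrow> real)"
        by (rule integrable_real_indicator) (use T in simp_all)
      ultimately show ?thesis by (simp add: square_integrable_def)
    qed
    have "V w = (\<integral>s. indicator {0..T} s \<bullet> norm (on_interval T y (w, s)) \<partial>lborel)"
      unfolding V_def by (intro Bochner_Integration.integral_cong refl) (simp add: on_interval_def indicator_def)
    then have "\<bar>V w\<bar> \<le> sqrt (\<integral>s. (norm (indicator {0..T} s :: real))\<^sup>2 \<partial>lborel) * sqrt (U w)"
      using Cauchy_Schwarz_integral[OF X Y] by (simp add: U_def)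
    also have "(\<integral>s. (norm (indicator {0..T} s :: real))\<^sup>2 \<partial>lborel) = T"
    proof -
      have "(\<lambda>s. (norm (indicator {0..T} s :: real))\<^sup>2) = indicator {0..T}"
        by (auto simp: indicator_def fun_eq_iff)
      then show ?thesis using T by simp
    qed
    finally have "\<bar>V w\<bar> \<le> sqrt (T * U w)" by (simp add: real_sqrt_mult)
    moreover have "0 \<le> T * U w" using T by (simp add: U_def)
    ultimately show ?thesis using sqrt_ge_absD by blast
  qed
  have "integrable M (\<lambda>w. (V w)\<^sup>2)"
  proof (rule Bochner_Integration.integrable_bound)
    show "integrable M (\<lambda>w. T * U w)" using Uint by simp
    show "(\<lambda>w. (V w)\<^sup>2) \<in> borel_measurable M" using Vmeas by measurable
    show "AE w in M. norm ((V w)\<^sup>2) \<le> norm (T * U w)" using VU by (intro AE_I2) force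
  qed
  then have "square_integrable M V" using Vmeas by (simp add: square_integrable_def)
  moreover have "square_integrable M (\<lambda>w. norm z)" by (simp add: square_integrable_def)
  ultimately have B: "square_integrable M (\<lambda>w. norm z + V w)" by (rule square_integrable_add[rotated])
  have KB: "norm (K r w) \<le> 1 * norm (norm z + V w)" if r: "0 \<le> r" "r \<le> T" and w: "w \<in> space M" for r w
  proof -
    have "norm (integral {0..r} (\<lambda>s. y s w)) \<le> (\<integral>s. norm (on_interval r y (w, s)) \<partial>lborel)"
      unfolding path_integral(2)[where y=y, OF cont[OF w] r(2)] by (rule integral_norm_bound)
    also have "\<dots> \<le> V w"
      unfolding V_def
    proof (rule integral_mono)
      show "norm (on_interval r y (w, s)) \<le> norm (on_interval T y (w, s))" for s
        using r by (simp add: on_interval_def indicator_def)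
    qed (use path_integral(1)[where y=y, OF cont[OF w] r(2)] path_integral(1)[where y=y, OF cont[OF w] order_refl] in simp_all)
    finally have J: "norm (integral {0..r} (\<lambda>s. y s w)) \<le> V w" .
    have "norm (K r w) \<le> norm z + norm (integral {0..r} (\<lambda>s. y s w))"
      unfolding K_def by (rule norm_triangle_ineq)
    with J show ?thesis by simp
  qed
  show "square_integrable M (K r)" if "0 \<le> r" "r \<le> T" for r
    by (rule square_integrable_dominated[OF B Kmeas[OF that] KB[OF that]])
  show "square_integrable cylinder (on_interval T K)"
  proof (rule square_integrable_dominated[OF square_integrable_on_interval_const[OF B, of T], of _ 1])
    show "on_interval T K \<in> borel_measurable cylinder"
      by (rule on_interval_measurable[OF T Kmeas Kcont])
    show "norm (on_interval T K p) \<le> 1 * norm (on_interval T (\<lambda>s w. norm z + V w) p)"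
      if "p \<in> space cylinder" for p
      using that KB by (auto simp: on_interval_def split_beta indicator_def space_pair_measure)
  qed
qed

lemma cylinder_integral_slices:
  fixes f :: "'w \<times> real \<Rightarrow> real"
  assumes "integrable cylinder f"
  shows "(\<integral>p. f p \<partial>cylinder) = (\<integral>s. expectation (\<lambda>w. f (w, s)) \<partial>lborel)"
  using cylinder.integral_snd[of "\<lambda>w s. f (w, s)"] assms by (simp only: case_prod_eta)

text \<open>The expectation of Ito's formula for a quadratic form. Split the solution into its drift part
  \<open>K\<close>, starting at \<open>x0\<close>, and its stochastic integral \<open>I\<close>. The form in \<open>K\<close> is evaluated path by path by the
  fundamental theorem of calculus, the form in \<open>I\<close> by the isometry. For the mixed term, \<open>K - x0\<close> is an
  integral over time, and the martingale property reduces the terminal value of \<open>I\<close> to its value at the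
  time of integration. The two integrals that involve \<open>K\<close> cancel.\<close>

lemma second_moment_formula:
  fixes F G \<Delta> :: "real^'n^'n"
  assumes sol: "sde_solution M W F G x0 x"
    and cont: "\<And>w. w \<in> space M \<Longrightarrow> continuous_on {0..} (\<lambda>t. x t w)"
    and sym: "transpose \<Delta> = \<Delta>" and T: "0 \<le> T"
  shows "expectation (\<lambda>w. x T w \<bullet> (\<Delta> *v x T w)) = x0 \<bullet> (\<Delta> *v x0)
    + (\<integral>p. on_interval T x p \<bullet> ((\<Delta> ** F + transpose F ** \<Delta> + transpose G ** \<Delta> ** G) *v on_interval T x p) \<partial>cylinder)"
proof -
  note sol' = sol[unfolded sde_solution_def]
  have symD: "u \<bullet> (\<Delta> *v v) = (\<Delta> *v u) \<bullet> v" for u v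
    using dot_lmul_matrix[of u \<Delta> v] vector_transpose_matrix[of u \<Delta>] sym by simp
  have adF: "x r \<in> borel_measurable (\<F> r)" if "0 \<le> r" for r using sol' that by blast
  have xM: "x r \<in> borel_measurable M" if "0 \<le> r" for r by (rule adapted_measurable[OF adF[OF that]])
  have sqx: "square_integrable M (x r)" if "0 \<le> r" for r
    using sol' that xM by (simp add: square_integrable_def)
  have contx: "continuous_on {0..r} (\<lambda>t. x t w)" if "w \<in> space M" for r w
    using cont[OF that] by (rule continuous_on_subset) simp
  have meas: "on_interval r x \<in> borel_measurable cylinder" if "0 \<le> r" for r
    by (rule on_interval_measurable[OF that xM contx])
  have sqc: "square_integrable cylinder (on_interval r x)" if r: "0 \<le> r" for r
  proof -
    note meas[OF r, measurable]
    have "(\<integral>\<^sup>+p. ennreal ((norm (on_interval r x p))\<^sup>2) \<partial>cylinder)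
        = (\<integral>\<^sup>+w. \<integral>\<^sup>+s. ennreal ((norm (on_interval r x (w, s)))\<^sup>2) \<partial>lborel \<partial>M)"
      by (rule lborel.nn_integral_fst[symmetric]) measurable
    also have "\<dots> = (\<integral>\<^sup>+w. (\<integral>\<^sup>+s\<in>{0..r}. ennreal ((norm (x s w))\<^sup>2) \<partial>lborel) \<partial>M)"
      by (intro nn_integral_cong) (simp add: on_interval_def indicator_def)
    also have "\<dots> < \<infinity>" using sol' r by blast
    finally show ?thesis using meas[OF r] by (simp add: square_integrable_iff_nn_integral)
  qed
  have mat: "on_interval r (\<lambda>s w. H *v x s w) = (\<lambda>p. H *v on_interval r x p)" for r and H :: "real^'n^'n"
    by (simp add: on_interval_def fun_eq_iff matrix_vector_mult_scaleR)
  have measH: "on_interval r (\<lambda>s w. H *v x s w) \<in> borel_measurable cylinder" if "0 \<le> r" for r and H :: "real^'n^'n"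
    unfolding mat by (rule square_integrable_measurable[OF square_integrable_matrix[OF sqc[OF that]]])
  define y where "y s w = F *v x s w" for s w
  define K where "K r w = x0 + integral {0..r} (\<lambda>s. y s w)" for r w
  have ymeas: "on_interval r y \<in> borel_measurable cylinder" if "0 \<le> r" for r
    unfolding y_def[abs_def] by (rule measH[OF that])
  have ycont: "continuous_on {0..r} (\<lambda>s. y s w)" if "w \<in> space M" for r w
    unfolding y_def by (intro bounded_linear.continuous_on[OF matrix_vector_mul_bounded_linear] contx that)
  have sqy: "square_integrable cylinder (on_interval T y)"
    unfolding y_def[abs_def] mat by (rule square_integrable_matrix[OF sqc[OF T]])
  note drift = time_integral_square_integrable[where y=y and z=x0, folded K_def, OF T _ _ sqy]
  have contK: "continuous_on {0..T} (\<lambda>r. K r w)" if "w \<in> space M" for w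
    by (rule drift(1)[OF ymeas ycont that])
  have sqK: "square_integrable M (K r)" if "0 \<le> r" "r \<le> T" for r
    by (rule drift(2)[OF ymeas ycont that])
  have sqKc: "square_integrable cylinder (on_interval T K)"
    by (rule drift(3)[OF ymeas ycont])
  obtain I where I: "\<And>r. 0 \<le> r \<Longrightarrow> has_ito_integral M W (\<lambda>s w. G *v x s w) r (I r)"
    and xI: "\<And>r. 0 \<le> r \<Longrightarrow> AE w in M. x r w = K r w + I r w"
  proof -
    have "\<forall>r. \<exists>J. 0 \<le> r \<longrightarrow> has_ito_integral M W (\<lambda>s w. G *v x s w) r J \<and> (AE w in M. x r w = K r w + J w)"
      using sol' unfolding K_def y_def by blast
    then obtain I where "\<forall>r. 0 \<le> r \<longrightarrow> has_ito_integral M W (\<lambda>s w. G *v x s w) r (I r) \<and> (AE w in M. x r w = K r w + I r w)"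
      using choice by metis
    then show ?thesis using that by blast
  qed
  have sqI: "square_integrable M (I r)" if r: "0 \<le> r" for r
    by (rule ito_approximation[OF I[OF r] r measH[OF r]])
  note sqKT = sqK[OF T order_refl]
  let ?y = "on_interval T y" and ?K = "on_interval T K" and ?x = "on_interval T x"
  have KDK: "expectation (\<lambda>w. K T w \<bullet> (\<Delta> *v K T w)) = x0 \<bullet> (\<Delta> *v x0) + 2 * (\<integral>p. ?y p \<bullet> (\<Delta> *v ?K p) \<partial>cylinder)"
  proof -
    have path: "K T w \<bullet> (\<Delta> *v K T w) = x0 \<bullet> (\<Delta> *v x0) + 2 * (\<integral>s. ?y (w, s) \<bullet> (\<Delta> *v ?K (w, s)) \<partial>lborel)"
      if w: "w \<in> space M" for w
    proof -
      have dK: "((\<lambda>r. K r w) has_vector_derivative y s w) (at s within {0..T})" if "s \<in> {0..T}" for s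
        unfolding K_def using integral_has_vector_derivative[OF ycont[OF w] that]
        by (auto intro!: derivative_eq_intros)
      have "((\<lambda>r. K r w \<bullet> (\<Delta> *v K r w)) has_vector_derivative 2 * (y s w \<bullet> (\<Delta> *v K s w))) (at s within {0..T})"
        if "s \<in> {0..T}" for s
      proof -
        note d = dK[OF that]
        have "((\<lambda>r. \<Delta> *v K r w) has_vector_derivative (\<Delta> *v y s w)) (at s within {0..T})"
          by (rule bounded_linear.has_vector_derivative[OF matrix_vector_mul_bounded_linear d])
        from bounded_bilinear.has_vector_derivative[OF bounded_bilinear_inner d this]
        show ?thesis by (simp add: symD[of "K s w"] inner_commute)
      qed
      then have "((\<lambda>s. 2 * (y s w \<bullet> (\<Delta> *v K s w))) has_integral
          (K T w \<bullet> (\<Delta> *v K T w) - K 0 w \<bullet> (\<Delta> *v K 0 w))) {0..T}"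
        by (rule fundamental_theorem_of_calculus[OF T])
      moreover have "K 0 w = x0" by (simp add: K_def)
      ultimately have "integral {0..T} (\<lambda>s. 2 * (y s w \<bullet> (\<Delta> *v K s w))) = K T w \<bullet> (\<Delta> *v K T w) - x0 \<bullet> (\<Delta> *v x0)"
        by (simp only: integral_unique)
      moreover have "integral {0..T} (\<lambda>s. 2 * (y s w \<bullet> (\<Delta> *v K s w)))
          = (\<integral>s. on_interval T (\<lambda>s w. 2 * (y s w \<bullet> (\<Delta> *v K s w))) (w, s) \<partial>lborel)"
        by (rule path_integral(2)[OF _ order_refl])
          (intro continuous_intros ycont[OF w] contK[OF w]
            bounded_linear.continuous_on[OF matrix_vector_mul_bounded_linear])
      moreover have "(\<integral>s. on_interval T (\<lambda>s w. 2 * (y s w \<bullet> (\<Delta> *v K s w))) (w, s) \<partial>lborel)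
          = (\<integral>s. 2 * (?y (w, s) \<bullet> (\<Delta> *v ?K (w, s))) \<partial>lborel)"
        by (intro Bochner_Integration.integral_cong refl) (simp add: on_interval_def indicator_def)
      ultimately show ?thesis by simp
    qed
    have i: "integrable cylinder (\<lambda>p. ?y p \<bullet> (\<Delta> *v ?K p))"
      by (rule integrable_inner[OF sqy square_integrable_matrix[OF sqKc]])
    have "expectation (\<lambda>w. K T w \<bullet> (\<Delta> *v K T w))
        = expectation (\<lambda>w. x0 \<bullet> (\<Delta> *v x0) + 2 * (\<integral>s. ?y (w, s) \<bullet> (\<Delta> *v ?K (w, s)) \<partial>lborel))"
      by (intro Bochner_Integration.integral_cong refl path)
    also have "\<dots> = x0 \<bullet> (\<Delta> *v x0) + 2 * expectation (\<lambda>w. \<integral>s. ?y (w, s) \<bullet> (\<Delta> *v ?K (w, s)) \<partial>lborel)"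
      using cylinder.integrable_fst'[OF i] by (simp add: prob_space)
    also have "expectation (\<lambda>w. \<integral>s. ?y (w, s) \<bullet> (\<Delta> *v ?K (w, s)) \<partial>lborel) = (\<integral>p. ?y p \<bullet> (\<Delta> *v ?K p) \<partial>cylinder)"
      by (rule cylinder.integral_fst'[OF i])
    finally show ?thesis .
  qed
  have KDI: "expectation (\<lambda>w. K T w \<bullet> (\<Delta> *v I T w))
      = (\<integral>p. ?y p \<bullet> (\<Delta> *v ?x p) \<partial>cylinder) - (\<integral>p. ?y p \<bullet> (\<Delta> *v ?K p) \<partial>cylinder)"
  proof -
    let ?I = "on_interval T (\<lambda>s. I T)"
    have sqIc: "square_integrable cylinder ?I" by (rule square_integrable_on_interval_const[OF sqI[OF T]])
    have i1: "integrable cylinder (\<lambda>p. ?y p \<bullet> (\<Delta> *v ?I p))"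
      by (rule integrable_inner[OF sqy square_integrable_matrix[OF sqIc]])
    have i2: "integrable cylinder (\<lambda>p. ?y p \<bullet> (\<Delta> *v ?x p))"
      by (rule integrable_inner[OF sqy square_integrable_matrix[OF sqc[OF T]]])
    have i3: "integrable cylinder (\<lambda>p. ?y p \<bullet> (\<Delta> *v ?K p))"
      by (rule integrable_inner[OF sqy square_integrable_matrix[OF sqKc]])
    have path: "K T w \<bullet> (\<Delta> *v I T w) = (\<Delta> *v x0) \<bullet> I T w + (\<integral>s. ?y (w, s) \<bullet> (\<Delta> *v ?I (w, s)) \<partial>lborel)"
      if w: "w \<in> space M" for w
    proof -
      have "(\<integral>s. ?y (w, s) \<bullet> (\<Delta> *v ?I (w, s)) \<partial>lborel) = (\<integral>s. ?y (w, s) \<bullet> (\<Delta> *v I T w) \<partial>lborel)"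
        by (intro Bochner_Integration.integral_cong refl) (simp add: on_interval_def indicator_def)
      also have "\<dots> = (\<integral>s. ?y (w, s) \<partial>lborel) \<bullet> (\<Delta> *v I T w)"
        by (rule integral_inner_left) (rule path_integral(1)[where y=y, OF ycont[OF w] order_refl])
      also have "(\<integral>s. ?y (w, s) \<partial>lborel) = K T w - x0"
        by (simp add: K_def path_integral(2)[where y=y, OF ycont[OF w] order_refl])
      finally show ?thesis by (simp add: inner_diff_left symD[of x0])
    qed
    \<comment> \<open>For fixed \<open>s\<close>, the martingale property replaces the terminal value \<open>I T\<close> by \<open>I s\<close>, and
      \<open>I s = x s - K s\<close> by the equation.\<close>
    have slice: "expectation (\<lambda>w. ?y (w, s) \<bullet> (\<Delta> *v ?I (w, s)))
        = expectation (\<lambda>w. ?y (w, s) \<bullet> (\<Delta> *v (?x (w, s) - ?K (w, s))))" for s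
    proof (cases "s \<in> {0..T}")
      case True
      then have s: "0 \<le> s" "s \<le> T" by auto
      have sqys: "square_integrable M (\<lambda>w. \<Delta> *v y s w)"
        unfolding y_def by (intro square_integrable_matrix sqx s)
      have ady: "(\<lambda>w. \<Delta> *v y s w) \<in> borel_measurable (\<F> s)"
        unfolding y_def matrix_vector_mul_assoc
        by (intro measurable_compose[OF adF[OF s(1)]]
            borel_measurable_continuous_onI linear_continuous_on matrix_vector_mul_bounded_linear)
      have "expectation (\<lambda>w. (\<Delta> *v y s w) \<bullet> I T w) = expectation (\<lambda>w. (\<Delta> *v y s w) \<bullet> I s w)"
        by (rule ito_martingale[OF I[OF T] I[OF s(1)] s measH[OF T] measH[OF s(1)] ady sqys])
      also have "\<dots> = expectation (\<lambda>w. (\<Delta> *v y s w) \<bullet> (x s w - K s w))"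
      proof (rule integral_cong_AE)
        show "(\<lambda>w. (\<Delta> *v y s w) \<bullet> I s w) \<in> borel_measurable M"
          using integrable_inner[OF sqys sqI[OF s(1)]] by (rule borel_measurable_integrable)
        show "(\<lambda>w. (\<Delta> *v y s w) \<bullet> (x s w - K s w)) \<in> borel_measurable M"
          using integrable_inner[OF sqys square_integrable_diff[OF sqx[OF s(1)] sqK[OF s]]]
          by (rule borel_measurable_integrable)
        show "AE w in M. (\<Delta> *v y s w) \<bullet> I s w = (\<Delta> *v y s w) \<bullet> (x s w - K s w)"
          using xI[OF s(1)] by eventually_elim simp
      qed
      finally show ?thesis using True by (simp add: on_interval_def symD)
    qed (simp add: on_interval_def)
    have "expectation (\<lambda>w. K T w \<bullet> (\<Delta> *v I T w))
        = expectation (\<lambda>w. (\<Delta> *v x0) \<bullet> I T w + (\<integral>s. ?y (w, s) \<bullet> (\<Delta> *v ?I (w, s)) \<partial>lborel))"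
      by (intro Bochner_Integration.integral_cong refl path)
    also have "\<dots> = expectation (\<lambda>w. (\<Delta> *v x0) \<bullet> I T w) + expectation (\<lambda>w. \<integral>s. ?y (w, s) \<bullet> (\<Delta> *v ?I (w, s)) \<partial>lborel)"
      using integrable_inner[OF _ sqI[OF T], of "\<lambda>w. \<Delta> *v x0"] cylinder.integrable_fst'[OF i1]
      by (intro Bochner_Integration.integral_add) (simp_all add: square_integrable_def)
    also have "\<dots> = (\<integral>p. ?y p \<bullet> (\<Delta> *v ?I p) \<partial>cylinder)"
      using ito_expectation_zero[OF I[OF T] T measH[OF T]] cylinder.integral_fst'[OF i1] by simp
    also have "\<dots> = (\<integral>s. expectation (\<lambda>w. ?y (w, s) \<bullet> (\<Delta> *v ?I (w, s))) \<partial>lborel)"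
      by (rule cylinder_integral_slices[OF i1])
    also have "\<dots> = (\<integral>s. expectation (\<lambda>w. ?y (w, s) \<bullet> (\<Delta> *v (?x (w, s) - ?K (w, s)))) \<partial>lborel)"
      by (simp only: slice)
    also have "\<dots> = (\<integral>p. ?y p \<bullet> (\<Delta> *v (?x p - ?K p)) \<partial>cylinder)"
      by (rule cylinder_integral_slices[symmetric])
        (rule integrable_inner[OF sqy square_integrable_matrix[OF square_integrable_diff[OF sqc[OF T] sqKc]]])
    also have "\<dots> = (\<integral>p. ?y p \<bullet> (\<Delta> *v ?x p) - ?y p \<bullet> (\<Delta> *v ?K p) \<partial>cylinder)"
      by (simp add: matrix_vector_mult_diff_distrib inner_diff_right)
    also have "\<dots> = (\<integral>p. ?y p \<bullet> (\<Delta> *v ?x p) \<partial>cylinder) - (\<integral>p. ?y p \<bullet> (\<Delta> *v ?K p) \<partial>cylinder)"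
      by (rule Bochner_Integration.integral_diff[OF i2 i3])
    finally show ?thesis .
  qed
  have IDI: "expectation (\<lambda>w. I T w \<bullet> (\<Delta> *v I T w)) = (\<integral>p. (G *v ?x p) \<bullet> (\<Delta> *v (G *v ?x p)) \<partial>cylinder)"
    using ito_isometry[OF I[OF T] T measH[OF T], of \<Delta>] by (simp only: mat)
  have "expectation (\<lambda>w. x T w \<bullet> (\<Delta> *v x T w))
      = expectation (\<lambda>w. K T w \<bullet> (\<Delta> *v K T w) + 2 * (K T w \<bullet> (\<Delta> *v I T w)) + I T w \<bullet> (\<Delta> *v I T w))"
  proof (rule integral_cong_AE)
    show "(\<lambda>w. x T w \<bullet> (\<Delta> *v x T w)) \<in> borel_measurable M"
      by (rule borel_measurable_integrable[OF integrable_inner[OF sqx[OF T] square_integrable_matrix[OF sqx[OF T]]]])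
    show "(\<lambda>w. K T w \<bullet> (\<Delta> *v K T w) + 2 * (K T w \<bullet> (\<Delta> *v I T w)) + I T w \<bullet> (\<Delta> *v I T w)) \<in> borel_measurable M"
      by (intro borel_measurable_add borel_measurable_times borel_measurable_const borel_measurable_integrable
          integrable_inner square_integrable_matrix sqKT sqI[OF T])
    show "AE w in M. x T w \<bullet> (\<Delta> *v x T w)
        = K T w \<bullet> (\<Delta> *v K T w) + 2 * (K T w \<bullet> (\<Delta> *v I T w)) + I T w \<bullet> (\<Delta> *v I T w)"
      using xI[OF T]
    proof eventually_elim
      case (elim w)
      have "I T w \<bullet> (\<Delta> *v K T w) = K T w \<bullet> (\<Delta> *v I T w)" by (simp add: symD[of "K T w"] inner_commute)
      then show ?case by (simp add: elim matrix_vector_right_distrib inner_add_left inner_add_right)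
    qed
  qed
  also have "\<dots> = expectation (\<lambda>w. K T w \<bullet> (\<Delta> *v K T w)) + 2 * expectation (\<lambda>w. K T w \<bullet> (\<Delta> *v I T w))
      + expectation (\<lambda>w. I T w \<bullet> (\<Delta> *v I T w))"
    using integrable_inner[OF sqKT square_integrable_matrix[OF sqKT], of \<Delta>]
      integrable_inner[OF sqKT square_integrable_matrix[OF sqI[OF T]], of \<Delta>]
      integrable_inner[OF sqI[OF T] square_integrable_matrix[OF sqI[OF T]], of \<Delta>] by simp
  also have "\<dots> = x0 \<bullet> (\<Delta> *v x0) + (2 * (\<integral>p. ?y p \<bullet> (\<Delta> *v ?x p) \<partial>cylinder)
      + (\<integral>p. (G *v ?x p) \<bullet> (\<Delta> *v (G *v ?x p)) \<partial>cylinder))"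
    unfolding KDK KDI IDI by simp
  also have "2 * (\<integral>p. ?y p \<bullet> (\<Delta> *v ?x p) \<partial>cylinder) + (\<integral>p. (G *v ?x p) \<bullet> (\<Delta> *v (G *v ?x p)) \<partial>cylinder)
      = (\<integral>p. 2 * (?y p \<bullet> (\<Delta> *v ?x p)) + (G *v ?x p) \<bullet> (\<Delta> *v (G *v ?x p)) \<partial>cylinder)"
  proof -
    have i1: "integrable cylinder (\<lambda>p. ?y p \<bullet> (\<Delta> *v ?x p))"
      by (rule integrable_inner[OF sqy square_integrable_matrix[OF sqc[OF T]]])
    have i2: "integrable cylinder (\<lambda>p. (G *v ?x p) \<bullet> (\<Delta> *v (G *v ?x p)))"
      by (intro integrable_inner square_integrable_matrix sqc[OF T])
    show ?thesis using i1 i2 by simp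
  qed
  also have "\<dots> = (\<integral>p. ?x p \<bullet> ((\<Delta> ** F + transpose F ** \<Delta> + transpose G ** \<Delta> ** G) *v ?x p) \<partial>cylinder)"
  proof (intro Bochner_Integration.integral_cong refl)
    fix p
    have tr: "u \<bullet> (v v* H) = (H *v u) \<bullet> v" for u v and H :: "real^'n^'n"
      using dot_lmul_matrix[of v H u] by (simp add: inner_commute)
    have y: "?y p = F *v ?x p" unfolding y_def[abs_def] mat ..
    show "2 * (?y p \<bullet> (\<Delta> *v ?x p)) + (G *v ?x p) \<bullet> (\<Delta> *v (G *v ?x p))
        = ?x p \<bullet> ((\<Delta> ** F + transpose F ** \<Delta> + transpose G ** \<Delta> ** G) *v ?x p)"
      unfolding y by (simp add: matrix_vector_mult_add_rdistrib inner_add_right tr symD[of "?x p"]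
          matrix_vector_mul_assoc[symmetric] inner_commute)
  qed
  finally show ?thesis .
qed

end

section \<open>The kernel of the Lyapunov operator\<close>

lemma zero_of_zero_quadratic_form:
  fixes \<Delta> :: "real^'n^'n"
  assumes sym: "transpose \<Delta> = \<Delta>" and zero: "\<And>v. v \<bullet> (\<Delta> *v v) = 0"
  shows "\<Delta> = 0"
proof -
  have "u \<bullet> (\<Delta> *v v) = 0" for u v
  proof -
    have "v \<bullet> (\<Delta> *v u) = u \<bullet> (\<Delta> *v v)"
      using dot_lmul_matrix[of v \<Delta> u] vector_transpose_matrix[of v \<Delta>] sym by (simp add: inner_commute)
    with zero[of "u + v"] show ?thesis
      by (simp add: matrix_vector_right_distrib inner_add_left inner_add_right zero)
  qed
  then have "\<Delta> *v v = 0" for v by (metis inner_eq_zero_iff)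
  then show ?thesis by (simp add: matrix_eq)
qed

text \<open>If \<open>\<Delta>\<close> is in the kernel of the Lyapunov operator, the expectation of the quadratic form \<open>\<Delta>\<close> is
  constant along each solution. Mean square stability makes it tend to zero, so the form vanishes at
  each initial value.\<close>

lemma ms_stable_lyapunov_kernel:
  fixes F G \<Delta> :: "real^'n^'n"
  assumes W: "brownian_motion M W" and stable: "ms_stable M W F G"
    and \<Delta>: "\<Delta> \<in> sym_mats" "\<Delta> ** F + transpose F ** \<Delta> + transpose G ** \<Delta> ** G = 0"
  shows "\<Delta> = 0"
proof (rule zero_of_zero_quadratic_form)
  show sym: "transpose \<Delta> = \<Delta>" using \<Delta>(1) by (simp add: sym_mats_def)
  interpret prob_space M using W by (simp add: brownian_motion_def)
  interpret brownian M W by unfold_locales (rule W)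
  fix x0
  obtain x where "sde_solution M W F G x0 x" using stable by (auto simp: ms_stable_def)
  then obtain x' where sol: "sde_solution M W F G x0 x'"
    and cont: "\<forall>w\<in>space M. continuous_on {0..} (\<lambda>t. x' t w)"
    by (rule continuous_solution)
  have const: "expectation (\<lambda>w. x' t w \<bullet> (\<Delta> *v x' t w)) = x0 \<bullet> (\<Delta> *v x0)" if "0 \<le> t" for t
    using second_moment_formula[OF sol bspec[OF cont] sym that] by (simp add: \<Delta>(2))
  obtain c where c: "\<And>v. norm (\<Delta> *v v) \<le> norm v * c"
    using bounded_linear.bounded[OF matrix_vector_mul_bounded_linear, of \<Delta>] by blast
  have bound: "norm (x0 \<bullet> (\<Delta> *v x0)) \<le> c * expectation (\<lambda>w. (norm (x' t w))\<^sup>2)" if t: "0 \<le> t" for t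
  proof -
    have sq: "square_integrable M (x' t)"
      using sol t by (auto simp: sde_solution_def square_integrable_def intro: adapted_measurable)
    have "\<bar>x0 \<bullet> (\<Delta> *v x0)\<bar> \<le> expectation (\<lambda>w. \<bar>x' t w \<bullet> (\<Delta> *v x' t w)\<bar>)"
      unfolding const[OF t, symmetric] by (rule integral_abs_bound)
    also have "\<dots> \<le> expectation (\<lambda>w. c * (norm (x' t w))\<^sup>2)"
    proof (rule integral_mono)
      show "integrable M (\<lambda>w. \<bar>x' t w \<bullet> (\<Delta> *v x' t w)\<bar>)"
        using integrable_inner[OF sq square_integrable_matrix[OF sq]] by simp
      show "integrable M (\<lambda>w. c * (norm (x' t w))\<^sup>2)" using sq by (simp add: square_integrable_def)
      show "\<bar>x' t w \<bullet> (\<Delta> *v x' t w)\<bar> \<le> c * (norm (x' t w))\<^sup>2" for w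
        using order_trans[OF Cauchy_Schwarz_ineq2 mult_left_mono[OF c norm_ge_zero], of "x' t w" "x' t w"]
        by (simp add: power2_eq_square mult_ac)
    qed
    finally show ?thesis by simp
  qed
  have "eventually (\<lambda>t. norm (x0 \<bullet> (\<Delta> *v x0)) \<le> c * expectation (\<lambda>w. (norm (x' t w))\<^sup>2)) at_top"
    by (rule eventually_mono[OF eventually_ge_at_top[of 0]]) (rule bound)
  moreover have "mean_square_decays M x'" using stable sol by (auto simp: ms_stable_def)
  then have "((\<lambda>t. c * expectation (\<lambda>w. (norm (x' t w))\<^sup>2)) \<longlongrightarrow> c * 0) at_top"
    unfolding mean_square_decays_def by (rule tendsto_mult_left)
  ultimately have "norm (x0 \<bullet> (\<Delta> *v x0)) \<le> c * 0"
    by (intro tendsto_lowerbound[where F="at_top :: real filter"]) simp_all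
  then show "x0 \<bullet> (\<Delta> *v x0) = 0" by simp
qed

section \<open>Inverses on the space of symmetric matrices\<close>

text \<open>A bound \<open>K\<close> on symmetric matrices is assumed because \<^const>\<open>sym_onorm\<close> is a supremum of reals, which
  says nothing unless the quotients are bounded above.\<close>

lemma sym_onorm_bound:
  fixes T :: "real^'n^'n \<Rightarrow> real^'n^'n"
  assumes "\<And>Y. Y \<in> sym_mats \<Longrightarrow> norm (T Y) \<le> norm Y * K" and X: "X \<in> sym_mats" and T0: "X = 0 \<Longrightarrow> T X = 0"
  shows "norm (T X) \<le> sym_onorm T * norm X"
proof (cases "X = 0")
  case False
  have "bdd_above ((\<lambda>Y. norm (T Y) / norm Y) ` sym_mats)"
  proof (rule bdd_aboveI2)
    fix Y :: "real^'n^'n" assume "Y \<in> sym_mats"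
    from assms(1)[OF this] have "norm (T Y) / norm Y \<le> K" if "Y \<noteq> 0"
      using that by (simp add: divide_le_eq mult.commute)
    then show "norm (T Y) / norm Y \<le> max K 0" by (cases "Y = 0") auto
  qed
  then have "norm (T X) / norm X \<le> sym_onorm T"
    unfolding sym_onorm_def by (rule cSUP_upper[OF X])
  then show ?thesis using False by (simp add: divide_le_eq)
qed (use T0 in simp)

text \<open>An operator that is injective on the symmetric matrices is bijective there, since the dimension is
  finite; only then is \<^const>\<open>inv_into\<close> a bounded linear inverse and the bound on its norm meaningful.
  Acting as the identity on skew matrices extends the operator to an injective map of the full matrix
  space, whose linear inverse restricts to the required one.\<close>

lemma norm_le_of_sym_inverse_bound:
  fixes L :: "real^'n^'n \<Rightarrow> real^'n^'n"
  assumes lin: "linear L" and maps: "\<And>X. X \<in> sym_mats \<Longrightarrow> L X \<in> sym_mats"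
    and ker: "\<And>X. X \<in> sym_mats \<Longrightarrow> L X = 0 \<Longrightarrow> X = 0"
    and bound: "sym_onorm (inv_into sym_mats L) \<le> a" and X: "X \<in> sym_mats"
  shows "norm X \<le> a * norm (L X)"
proof -
  interpret L: linear L by (rule lin)
  have tr: "transpose (c *\<^sub>R Z) = c *\<^sub>R transpose Z" for c and Z :: "real^'n^'n"
    by (simp add: transpose_scalar)
  define S where "S Z = (1/2) *\<^sub>R (Z + transpose Z)" for Z :: "real^'n^'n"
  have S_sym: "S Z \<in> sym_mats" for Z
    by (simp add: S_def sym_mats_def tr transpose_add transpose_transpose add.commute)
  have S_id: "S Z = Z" if "Z \<in> sym_mats" for Z
    using that by (simp add: S_def sym_mats_def scaleR_2[symmetric])
  have S_skew: "transpose (Z - S Z) = - (Z - S Z)" for Z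
    by (simp add: S_def vec_eq_iff transpose_def field_simps)
  have S_lin: "linear S"
    by (rule linearI) (simp_all add: S_def tr transpose_add algebra_simps)
  interpret S: linear S by (rule S_lin)
  define L' where "L' Z = L (S Z) + (Z - S Z)" for Z
  have L'_lin: "linear L'"
    by (rule linearI) (simp_all add: L'_def L.add S.add L.scaleR S.scaleR algebra_simps)
  have skew: "Z = S Z" if "L' Z \<in> sym_mats" for Z
  proof -
    have "transpose (L (S Z)) = L (S Z)" using maps[OF S_sym] by (simp add: sym_mats_def)
    moreover have "transpose (L' Z) = L' Z" using that by (simp add: sym_mats_def)
    ultimately have "- (Z - S Z) = Z - S Z" unfolding L'_def transpose_add S_skew by simp
    then have "2 *\<^sub>R (Z - S Z) = 0" by (simp add: scaleR_2 eq_neg_iff_add_eq_0 neg_eq_iff_add_eq_0)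
    then show ?thesis by simp
  qed
  have "inj L'"
  proof (rule linear_injective_0[OF L'_lin, THEN iffD2], intro allI impI)
    fix Z assume Z: "L' Z = 0"
    then have "Z = S Z" by (intro skew) (simp add: sym_mats_def transpose_def vec_eq_iff)
    then show "Z = 0" using ker[OF S_sym[of Z]] Z by (simp add: L'_def)
  qed
  then obtain g where g: "linear g" "\<And>Z. g (L' Z) = Z" "\<And>Z. L' (g Z) = Z"
    using linear_injective_isomorphism[OF L'_lin] by blast
  have inj: "inj_on L sym_mats"
  proof (rule inj_onI)
    fix Y Z assume Y: "Y \<in> sym_mats" and Z: "Z \<in> sym_mats" and eq: "L Y = L Z"
    have "Y - Z \<in> sym_mats" using Y Z by (simp add: sym_mats_def transpose_diff)
    moreover have "L (Y - Z) = 0" using eq by (simp only: L.diff diff_self)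
    ultimately have "Y - Z = 0" by (rule ker)
    then show "Y = Z" by simp
  qed
  have inv: "inv_into sym_mats L Y = g Y" if "Y \<in> sym_mats" for Y
  proof -
    have gY: "g Y = S (g Y)" using that by (intro skew) (simp add: g(3))
    then have sym: "g Y \<in> sym_mats" using S_sym[of "g Y"] by simp
    have "L (g Y) = Y" using g(3)[of Y] gY by (simp add: L'_def)
    then show ?thesis using inv_into_f_f[OF inj sym] by simp
  qed
  obtain K where K: "\<And>Y. norm (g Y) \<le> norm Y * K"
    using bounded_linear.bounded[of g] g(1) by (auto simp: linear_conv_bounded_linear)
  have "norm (inv_into sym_mats L (L X)) \<le> sym_onorm (inv_into sym_mats L) * norm (L X)"
    by (rule sym_onorm_bound[of _ K]) (use K linear_0[OF g(1)] maps[OF X] in \<open>simp_all add: inv\<close>)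
  also have "\<dots> \<le> a * norm (L X)" by (rule mult_right_mono[OF bound norm_ge_zero])
  finally show ?thesis using inv_into_f_f[OF inj X] by simp
qed

section \<open>Newton steps for the Riccati equation\<close>

lemmas matrix_mult_distribs =
  bounded_bilinear.add_left[OF bounded_bilinear_matrix_mult]
  bounded_bilinear.add_right[OF bounded_bilinear_matrix_mult]
  bounded_bilinear.diff_left[OF bounded_bilinear_matrix_mult]
  bounded_bilinear.diff_right[OF bounded_bilinear_matrix_mult]
  bounded_bilinear.scaleR_left[OF bounded_bilinear_matrix_mult]
  bounded_bilinear.scaleR_right[OF bounded_bilinear_matrix_mult]

text \<open>The matrix of the quadratic term of the Riccati equation. With it the Riccati operator is
  \<open>P A + A\<^sup>T P + A1\<^sup>T P A1 + P N P + Q\<close>, and the terms for the two players no longer occur separately.\<close>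

definition game_gain :: "real^'m^'n \<Rightarrow> real^'p^'n \<Rightarrow> real^'m^'m \<Rightarrow> real \<Rightarrow> real^'n^'n" where
  "game_gain B E R \<gamma> = (1 / \<gamma>\<^sup>2) *\<^sub>R (E ** transpose E) - B ** matrix_inv R ** transpose B"

lemma closed_loop_eq: "closed_loop A B E R \<gamma> P = A + game_gain B E R \<gamma> ** P"
  by (simp add: closed_loop_def game_gain_def matrix_mult_distribs algebra_simps)

lemma riccati_op_eq:
  "riccati_op A A1 B E Q R \<gamma> P = P ** A + transpose A ** P + transpose A1 ** P ** A1
     + P ** game_gain B E R \<gamma> ** P + Q"
  by (simp add: riccati_op_def game_gain_def matrix_mult_distribs matrix_mul_assoc algebra_simps)

lemma spu_weight_eq: "spu_weight B E Q R \<gamma> P = Q - P ** game_gain B E R \<gamma> ** P"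
  by (simp add: spu_weight_def game_gain_def matrix_mult_distribs matrix_mul_assoc algebra_simps)

lemma transpose_game_gain:
  assumes "invertible R" "transpose R = R"
  shows "transpose (game_gain B E R \<gamma>) = game_gain B E R \<gamma>"
  by (simp add: game_gain_def transpose_diff transpose_scalar matrix_transpose_mul
      transpose_transpose transpose_matrix_inv_sym[OF assms] matrix_mul_assoc)

lemma linear_riccati_deriv: "linear (riccati_deriv A A1 B E R \<gamma> P)"
  by (rule linearI) (simp_all add: riccati_deriv_def matrix_mult_distribs algebra_simps)

lemma riccati_deriv_sym:
  assumes "X \<in> sym_mats" shows "riccati_deriv A A1 B E R \<gamma> P X \<in> sym_mats"
  using assms
  by (simp add: sym_mats_def riccati_deriv_def transpose_add matrix_transpose_mul transpose_transpose
      matrix_mul_assoc add.commute)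

text \<open>For \<open>\<Delta> = X - Y\<close> the right side is twice the quadratic remainder of the Riccati operator, so that a
  Lipschitz constant of the derivative also bounds the remainder, with the factor one half.\<close>

lemma riccati_deriv_diff:
  assumes sym: "X \<in> sym_mats" "Y \<in> sym_mats" and R: "invertible R" "transpose R = R"
  shows "riccati_deriv A A1 B E R \<gamma> X \<Delta> - riccati_deriv A A1 B E R \<gamma> Y \<Delta>
    = \<Delta> ** game_gain B E R \<gamma> ** (X - Y) + (X - Y) ** game_gain B E R \<gamma> ** \<Delta>"
  using sym
  by (simp add: riccati_deriv_def closed_loop_eq sym_mats_def transpose_add matrix_transpose_mul
      transpose_game_gain[OF R] matrix_mult_distribs matrix_mul_assoc algebra_simps)

text \<open>An update step solves the linearization of the Riccati equation at \<open>P\<close>, hence is a Newton step. As the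
  equation is quadratic, the error of the linearization at the root is exactly the quadratic term.\<close>

lemma spu_step_error:
  assumes sym: "P \<in> sym_mats" "Pstar \<in> sym_mats" and R: "invertible R" "transpose R = R"
    and root: "riccati_op A A1 B E Q R \<gamma> Pstar = 0"
    and step: "spu_step A A1 B E Q R \<gamma> P P'"
  shows "riccati_deriv A A1 B E R \<gamma> P (P' - Pstar) = (P - Pstar) ** game_gain B E R \<gamma> ** (P - Pstar)"
proof -
  let ?N = "game_gain B E R \<gamma>"
  have new: "riccati_deriv A A1 B E R \<gamma> P P' = P ** ?N ** P - Q"
    using step by (simp add: spu_step_def riccati_deriv_def spu_weight_eq algebra_simps)
  have old: "riccati_deriv A A1 B E R \<gamma> P Pstar
      = riccati_op A A1 B E Q R \<gamma> Pstar - Q - Pstar ** ?N ** Pstar + Pstar ** ?N ** P + P ** ?N ** Pstar"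
    using sym
    by (simp add: riccati_deriv_def riccati_op_eq closed_loop_eq sym_mats_def transpose_add
        matrix_transpose_mul transpose_game_gain[OF R] matrix_mult_distribs matrix_mul_assoc algebra_simps)
  have "riccati_deriv A A1 B E R \<gamma> P (P' - Pstar)
      = riccati_deriv A A1 B E R \<gamma> P P' - riccati_deriv A A1 B E R \<gamma> P Pstar"
    by (rule linear_diff[OF linear_riccati_deriv])
  then show ?thesis unfolding new old root by (simp add: matrix_mult_distribs algebra_simps)
qed

lemma riccati_deriv_lipschitz:
  assumes lip: "sym_onorm (\<lambda>\<Delta>. riccati_deriv A A1 B E R \<gamma> X \<Delta> - riccati_deriv A A1 B E R \<gamma> Y \<Delta>)
      \<le> c * norm (X - Y)" and \<Delta>: "\<Delta> \<in> sym_mats"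
  shows "norm (riccati_deriv A A1 B E R \<gamma> X \<Delta> - riccati_deriv A A1 B E R \<gamma> Y \<Delta>) \<le> c * norm (X - Y) * norm \<Delta>"
proof -
  let ?T = "\<lambda>\<Delta>. riccati_deriv A A1 B E R \<gamma> X \<Delta> - riccati_deriv A A1 B E R \<gamma> Y \<Delta>"
  have lin: "linear ?T" by (intro linear_compose_sub linear_riccati_deriv)
  then obtain K where K: "\<And>Z. norm (?T Z) \<le> norm Z * K"
    using bounded_linear.bounded[of ?T] by (auto simp: linear_conv_bounded_linear)
  have "norm (?T \<Delta>) \<le> sym_onorm ?T * norm \<Delta>"
    by (rule sym_onorm_bound[OF K \<Delta>]) (use linear_0[OF lin] in simp)
  also have "\<dots> \<le> c * norm (X - Y) * norm \<Delta>" by (rule mult_right_mono[OF lip norm_ge_zero])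
  finally show ?thesis .
qed

section \<open>Convergence of the policy updates\<close>

lemma invertible_gram_matrix:
  fixes D :: "real^'m^'r"
  assumes "rank D = CARD('m)"
  shows "invertible (transpose D ** D)"
proof -
  have inj: "inj ((*v) D)" using assms by (simp add: full_rank_injective)
  have "x = 0" if "(transpose D ** D) *v x = 0" for x
  proof -
    have "(D *v x) \<bullet> (D *v x) = x \<bullet> ((transpose D ** D) *v x)"
      using dot_lmul_matrix[of x "transpose D" "D *v x"]
      by (simp add: matrix_vector_mul_assoc[symmetric])
    then have "D *v x = D *v 0" using that by simp
    from injD[OF inj this] show ?thesis .
  qed
  then show ?thesis
    by (simp add: invertible_left_inverse matrix_left_invertible_ker)
qed

theorem theorem1:
  fixes M :: "'w measure" and W :: "real \<Rightarrow> 'w \<Rightarrow> real"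
    and A A1 :: "real^'n^'n" and B :: "real^'m^'n" and E :: "real^'p^'n"
    and C :: "real^'n^'q" and D :: "real^'m^'r"
    and Q :: "real^'n^'n" and R :: "real^'m^'m"
    and \<gamma> c0 a0 :: real
    and Pstar :: "real^'n^'n" and P :: "nat \<Rightarrow> real^'n^'n"
  assumes W: "brownian_motion M W"
    and D: "rank D = CARD('m)"
    and Q: "Q = transpose C ** C"
    and R: "R = transpose D ** D"
    and \<gamma>: "\<gamma> > 0"
    and Pstar: "stabilizing_solution M W A A1 B E Q R \<gamma> Pstar"
    and Pstar_unique: "\<And>X. stabilizing_solution M W A A1 B E Q R \<gamma> X \<Longrightarrow> X = Pstar"
    and detectable: "exactly_detectable M W A A1 C"
    and detectable_Pstar:
      "exactly_detectable M W (A + (1 / \<gamma>\<^sup>2) *\<^sub>R (E ** transpose E ** Pstar)) A1 C"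
    and stabilizable: "internally_stabilizable M W A A1 B"
    and c0: "c0 > 0"
    and lipschitz: "\<And>X Y. X \<in> sym_mats \<Longrightarrow> Y \<in> sym_mats \<Longrightarrow>
      sym_onorm (\<lambda>\<Delta>. riccati_deriv A A1 B E R \<gamma> X \<Delta> - riccati_deriv A A1 B E R \<gamma> Y \<Delta>)
        \<le> c0 * norm (X - Y)"
    and a0: "a0 > 0"
    and inverse_bound:
      "sym_onorm (inv_into sym_mats (riccati_deriv A A1 B E R \<gamma> Pstar)) \<le> a0"
    and P_0: "P 0 \<in> initial_region c0 a0 Pstar"
    and P_Suc: "\<And>i. spu_step A A1 B E Q R \<gamma> (P i) (P (Suc i))"
  shows "P \<longlonglongrightarrow> Pstar"
proof -
  let ?L = "\<lambda>X. riccati_deriv A A1 B E R \<gamma> X"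
  have R_inv: "invertible R" unfolding R by (rule invertible_gram_matrix[OF D])
  have R_sym: "transpose R = R" by (simp add: R matrix_transpose_mul transpose_transpose)
  have Pstar_sym: "Pstar \<in> sym_mats" and root: "riccati_op A A1 B E Q R \<gamma> Pstar = 0"
    and stable: "ms_stable M W (closed_loop A B E R \<gamma> Pstar) A1"
    using Pstar by (simp_all add: stabilizing_solution_def psd_mats_def)
  have kernel: "X = 0" if "X \<in> sym_mats" "?L Pstar X = 0" for X
    using ms_stable_lyapunov_kernel[OF W stable that(1)] that(2) by (simp add: riccati_deriv_def)
  have inverse: "norm X \<le> a0 * norm (?L Pstar X)" if "X \<in> sym_mats" for X
    by (rule norm_le_of_sym_inverse_bound[OF linear_riccati_deriv riccati_deriv_sym kernel inverse_bound that])
  have P_sym: "P i \<in> sym_mats" for i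
    using P_0 P_Suc by (cases i) (auto simp: initial_region_def psd_mats_def spu_step_def)
  define e where "e i = norm (P i - Pstar)" for i
  \<comment> \<open>Replacing the derivative at \<open>P i\<close> by the one at \<open>Pstar\<close>, where the inverse is bounded, costs the
    second summand.\<close>
  have newton: "e (Suc i) \<le> a0 * (c0 / 2 * e i * e i + c0 * e i * e (Suc i))" for i
  proof -
    let ?d = "P i - Pstar" and ?d' = "P (Suc i) - Pstar"
    have sym: "?d \<in> sym_mats" "?d' \<in> sym_mats"
      using P_sym Pstar_sym by (simp_all add: sym_mats_def transpose_diff)
    note lip = riccati_deriv_lipschitz[OF lipschitz[OF P_sym[of i] Pstar_sym]]
    have residual: "?L (P i) ?d' = ?d ** game_gain B E R \<gamma> ** ?d"
      by (rule spu_step_error[OF P_sym Pstar_sym R_inv R_sym root P_Suc])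
    have "?L (P i) ?d - ?L Pstar ?d = 2 *\<^sub>R (?d ** game_gain B E R \<gamma> ** ?d)"
      unfolding riccati_deriv_diff[OF P_sym Pstar_sym R_inv R_sym] by (simp add: scaleR_2)
    with lip[OF sym(1)] have quadratic: "norm (?d ** game_gain B E R \<gamma> ** ?d) \<le> c0 / 2 * e i * e i"
      by (simp add: e_def)
    have "?L Pstar ?d' = ?d ** game_gain B E R \<gamma> ** ?d - (?L (P i) ?d' - ?L Pstar ?d')"
      by (simp add: residual)
    then have "norm (?L Pstar ?d') \<le> norm (?d ** game_gain B E R \<gamma> ** ?d) + norm (?L (P i) ?d' - ?L Pstar ?d')"
      by (metis norm_triangle_ineq4)
    with quadratic lip[OF sym(2)] have "norm (?L Pstar ?d') \<le> c0 / 2 * e i * e i + c0 * e i * e (Suc i)"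
      by (simp add: e_def)
    with inverse[OF sym(2)] a0 show ?thesis
      unfolding e_def[of "Suc i"] by (meson mult_left_mono less_imp_le order_trans)
  qed
  have contraction: "e (Suc i) \<le> e i / 2" if small: "a0 * c0 * e i \<le> 1 / 2" for i
  proof -
    \<comment> \<open>With \<open>q \<le> 1/2\<close> the Newton estimate reads \<open>(1 - q) e' \<le> q e/2 \<le> (1 - q) e/2\<close>.\<close>
    define q where "q = a0 * c0 * e i"
    have pos: "0 \<le> e i" "0 \<le> e (Suc i)" by (simp_all add: e_def)
    have "e (Suc i) * (1 - q) \<le> q * (e i / 2)"
      using newton[of i] by (simp add: q_def algebra_simps)
    also have "\<dots> \<le> (1 - q) * (e i / 2)"
      using small pos by (intro mult_right_mono) (simp_all add: q_def)
    finally have "(1 - q) * e (Suc i) \<le> (1 - q) * (e i / 2)" by (simp add: mult.commute)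
    then show ?thesis using small by (simp add: q_def)
  qed
  have start: "a0 * c0 * e 0 \<le> 1 / 2"
  proof -
    have "e 0 \<le> (2 - sqrt 2) / (2 * c0 * a0)" using P_0 by (simp add: initial_region_def e_def)
    then have "a0 * c0 * e 0 \<le> a0 * c0 * ((2 - sqrt 2) / (2 * c0 * a0))"
      using a0 c0 by (intro mult_left_mono) simp_all
    also have "\<dots> = (2 - sqrt 2) / 2" using a0 c0 by simp
    also have "\<dots> \<le> 1 / 2" by simp
    finally show ?thesis .
  qed
  have "a0 * c0 * e i \<le> 1 / 2 \<and> e i \<le> e 0 * (1 / 2) ^ i" for i
  proof (induction i)
    case 0
    then show ?case using start by simp
  next
    case (Suc i)
    then have half: "e (Suc i) \<le> e i / 2" using contraction by blast
    moreover have "0 \<le> e i" by (simp add: e_def)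
    ultimately have "a0 * c0 * e (Suc i) \<le> a0 * c0 * e i"
      using a0 c0 by (intro mult_left_mono) simp_all
    then show ?case using Suc half by simp
  qed
  then have bound: "\<bar>e i\<bar> \<le> e 0 * (1 / 2) ^ i" for i by (simp add: e_def)
  have "(\<lambda>i. e 0 * (1 / 2) ^ i) \<longlonglongrightarrow> e 0 * 0"
    by (intro tendsto_mult_left LIMSEQ_power_zero) simp
  then have "e \<longlonglongrightarrow> 0" using null_sequence_comparison[OF bound] by simp
  then have "(\<lambda>i. P i - Pstar) \<longlonglongrightarrow> 0"
    unfolding e_def[abs_def] by (rule tendsto_norm_zero_cancel)
  then show ?thesis by (rule LIM_zero_cancel)
qed

end
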